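(* Let $A=A^{(0)}+A^{(1)}\varepsilon$, $B=B^{(0)}+B^{(1)}\varepsilon$, $G_2=g_2+\tilde g_2\varepsilon$, $G_3=g_3+\tilde g_3\varepsilon$, $Z_0=z_0+\tilde z_0\varepsilon$, $Z=z+\tilde z\varepsilon$ be given parameters in $\mathbb{D}$, and write $\sigma(\cdot)=\sigma(\cdot\,;G_2,G_3)$. Then the expression $$X_n = A\,B^n\,\frac{\sigma(Z_0+nZ)}{\sigma(Z)^{n^2}}$$ satisfies the dual Somos-4 recurrence $$X_{n+4}X_n = \alpha\, X_{n+3}X_{n+1}+\beta\, X_{n+2}^2$$ with coefficients $$\alpha=\alpha^{(0)}+\alpha^{(1)}\varepsilon=\frac{\sigma(2Z)^2}{\sigma(Z)^8},\qquad \beta=\beta^{(0)}+\beta^{(1)}\varepsilon=-\frac{\sigma(3Z)}{\sigma(Z)^9},$$ provided that $A,B\in\mathbb{D}^*$ and $\sigma(Z)\in\mathbb{D}^*$. In terms of even/odd components, this can be written as $$X_n = x_n + x_n\left(\frac{A^{(1)}}{A^{(0)}}+\frac{B^{(1)}}{B^{(0)}}\,n+\tilde z_0\,\zeta(z_0+nz)+\big(\tilde z\,\partial_z+\tilde g_2\,\partial_{g_2}+\tilde g_3\,\partial_{g_3}\big)\log x_n\right)\varepsilon,$$ where $$x_n=A^{(0)}\,(B^{(0)})^n\,\frac{\sigma(z_0+nz;g_2,g_3)}{\sigma(z;g_2,g_3)^{n^2}},$$ $\zeta(\cdot)=\zeta(\cdot\,;g_2,g_3)$ is the Weierstrass zeta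 function, and $\partial$ denotes a partial derivative.
   Context: $\mathbb{D}=\{x+y\varepsilon : x,y\in\mathbb{C},\ \varepsilon^2=0\}$ is the commutative $\mathbb{C}$-algebra of dual numbers, with group of units $\mathbb{D}^*=\{x+y\varepsilon\in\mathbb{D}: x\neq0\}$. Holomorphic functions are evaluated at dual numbers by first-order Taylor expansion: $\Phi(x_1+y_1\varepsilon,\dots,x_k+y_k\varepsilon)=\Phi(x_1,\dots,x_k)+\sum_i y_i\,\partial_i\Phi(x_1,\dots,x_k)\,\varepsilon$. $\sigma(z;g_2,g_3)$ is the Weierstrass sigma function associated with the curve $\mathrm{y}^2=4\mathrm{x}^3-g_2\mathrm{x}-g_3$; it is holomorphic in $z,g_2,g_3$. $\zeta=\partial_z\log\sigma$. The partial derivatives $\partial_z,\partial_{g_2},\partial_{g_3}$ act on $x_n$ regarded as a function of the independent parameters $A^{(0)},B^{(0)},z_0,z,g_2,g_3$. *)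

theory Defs
  imports "HOL-Complex_Analysis.Complex_Analysis"
begin

section \<open>Dual numbers\<close>

text \<open>\<open>Dual x y\<close> stands for \<open>x + y \<epsilon>\<close> with \<open>\<epsilon>\<^sup>2 = 0\<close>.\<close>

datatype dual = Dual (even_part: complex) (odd_part: complex)

instantiation dual :: comm_ring_1
begin

definition zero_dual :: dual where "0 = Dual 0 0"
definition one_dual :: dual where "1 = Dual 1 0"
definition plus_dual :: "dual \<Rightarrow> dual \<Rightarrow> dual" where
  "X + Y = Dual (even_part X + even_part Y) (odd_part X + odd_part Y)"
definition uminus_dual :: "dual \<Rightarrow> dual" where
  "- X = Dual (- even_part X) (- odd_part X)"
definition minus_dual :: "dual \<Rightarrow> dual \<Rightarrow> dual" where
  "X - Y = Dual (even_part X - even_part Y) (odd_part X - odd_part Y)"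
definition times_dual :: "dual \<Rightarrow> dual \<Rightarrow> dual" where
  "X * Y = Dual (even_part X * even_part Y)
                (even_part X * odd_part Y + odd_part X * even_part Y)"

instance
  by standard
     (auto simp: zero_dual_def one_dual_def plus_dual_def uminus_dual_def minus_dual_def
        times_dual_def algebra_simps)

end

definition dual_units :: "dual set" where
  "dual_units = {X. even_part X \<noteq> 0}"

text \<open>
  The inverse is meaningful only on \<^const>\<open>dual_units\<close>; following the convention for fields,
  it is set to \<open>0\<close> elsewhere.
\<close>

instantiation dual :: inverse
begin

definition inverse_dual :: "dual \<Rightarrow> dual" where
  "inverse X = (if even_part X = 0 then 0
     else Dual (inverse (even_part X)) (- odd_part X / (even_part X)\<^sup>2))"
definition divide_dual :: "dual \<Rightarrow> dual \<Rightarrow> dual" where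
  "divide X Y = X * inverse (Y :: dual)"

instance ..

end

lemma dual_mult_inverse:
  assumes "X \<in> dual_units"
  shows "X * inverse X = 1"
  using assms
  by (simp add: dual_units_def times_dual_def inverse_dual_def one_dual_def power2_eq_square field_simps)

lemma dual_units_iff_dvd: "X \<in> dual_units \<longleftrightarrow> X dvd 1"
proof
  assume "X \<in> dual_units"
  then show "X dvd 1" by (metis dual_mult_inverse dvd_triv_left)
next
  assume "X dvd 1"
  then obtain Y where "1 = X * Y" by (elim dvdE)
  then show "X \<in> dual_units" by (auto simp: dual_units_def times_dual_def one_dual_def)
qed

lemma Dual_eq: "Dual x y = Dual x 0 + Dual y 0 * Dual 0 1"
  and dual_eps_squared: "Dual 0 1 * Dual 0 1 = 0"
  by (simp_all add: plus_dual_def times_dual_def zero_dual_def)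

text \<open>First-order Taylor expansion of a function of three complex variables at dual arguments.\<close>

definition dual_eval3 ::
    "(complex \<Rightarrow> complex \<Rightarrow> complex \<Rightarrow> complex) \<Rightarrow> dual \<Rightarrow> dual \<Rightarrow> dual \<Rightarrow> dual" where
  "dual_eval3 \<Phi> X Y Z =
     (let x = even_part X; y = even_part Y; z = even_part Z in
      Dual (\<Phi> x y z)
           (odd_part X * deriv (\<lambda>t. \<Phi> t y z) x
          + odd_part Y * deriv (\<lambda>t. \<Phi> x t z) y
          + odd_part Z * deriv (\<lambda>t. \<Phi> x y t) z))"

section \<open>Logarithmic derivative\<close>

definition log_deriv :: "(complex \<Rightarrow> complex) \<Rightarrow> complex \<Rightarrow> complex" where
  "log_deriv f w = deriv f w / f w"

text \<open>
  \<^const>\<open>log_deriv\<close> is the derivative of \<open>log f\<close> for every local branch of the logarithm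
  (whereas \<open>deriv (\<lambda>w. Ln (f w))\<close> would fail on the branch cut of \<^const>\<open>Ln\<close>).
\<close>

lemma log_deriv_branch:
  assumes "eventually (\<lambda>u. exp (L u) = f u) (nhds w)"
    and "(L has_field_derivative d) (at w)"
  shows "log_deriv f w = d"
proof -
  have fw: "exp (L w) = f w"
    using assms(1) by (rule eventually_nhds_x_imp_x)
  have "((\<lambda>u. exp (L u)) has_field_derivative exp (L w) * d) (at w)"
    using assms(2) by (auto intro!: derivative_eq_intros)
  then have "deriv (\<lambda>u. exp (L u)) w = exp (L w) * d"
    by (rule DERIV_imp_deriv)
  moreover have "deriv (\<lambda>u. exp (L u)) w = deriv f w"
    using assms(1) by (intro deriv_cong_ev) auto
  ultimately show ?thesis
    by (simp add: log_deriv_def flip: fw)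
qed

section \<open>The Weierstrass functions of a cubic curve\<close>

text \<open>
  The sigma function of the curve \<open>y\<^sup>2 = 4 x\<^sup>3 - g2 x - g3\<close> is the odd entire function
  \<open>\<sigma>(z) = z + O(z\<^sup>3)\<close> for which \<open>x = \<wp>(z)\<close>, \<open>y = \<wp>'(z)\<close> with \<open>\<wp> = - (log \<sigma>)''\<close> parametrises
  the curve.  It exists and is unique for all complex \<open>g2\<close>, \<open>g3\<close>: the differential equation
  determines the Laurent expansion of \<open>\<wp>\<close> at its double pole \<open>0\<close>, and oddness together with
  \<open>\<sigma>'(0) = 1\<close> fixes the two constants of integration.  If \<open>g2\<^sup>3 \<noteq> 27 g3\<^sup>2\<close> it is the
  sigma function of the period lattice with invariants \<open>g2\<close>, \<open>g3\<close>; singular curves, which have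
  no such lattice, are covered as well, so that \<open>\<sigma>\<close> is a function on all of \<open>\<complex>\<^sup>3\<close>.
\<close>

definition wp_of_sigma :: "(complex \<Rightarrow> complex) \<Rightarrow> complex \<Rightarrow> complex" where
  "wp_of_sigma f z = - deriv (log_deriv f) z"

definition is_weierstrass_sigma :: "complex \<Rightarrow> complex \<Rightarrow> (complex \<Rightarrow> complex) \<Rightarrow> bool" where
  "is_weierstrass_sigma g2 g3 f \<longleftrightarrow>
     f holomorphic_on UNIV \<and>
     (\<forall>z. f (- z) = - f z) \<and>
     deriv f 0 = 1 \<and>
     (\<forall>z. f z \<noteq> 0 \<longrightarrow>
        (deriv (wp_of_sigma f) z)\<^sup>2 = 4 * wp_of_sigma f z ^ 3 - g2 * wp_of_sigma f z - g3)"

definition weierstrass_sigma :: "complex \<Rightarrow> complex \<Rightarrow> complex \<Rightarrow> complex" where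
  "weierstrass_sigma z g2 g3 = (THE f. is_weierstrass_sigma g2 g3 f) z"

definition weierstrass_zeta :: "complex \<Rightarrow> complex \<Rightarrow> complex \<Rightarrow> complex" where
  "weierstrass_zeta z g2 g3 = log_deriv (\<lambda>t. weierstrass_sigma t g2 g3) z"

definition dual_sigma :: "dual \<Rightarrow> dual \<Rightarrow> dual \<Rightarrow> dual" where
  "dual_sigma = dual_eval3 weierstrass_sigma"

section \<open>Somos-4 sequences\<close>

definition somos4_seq ::
    "complex \<Rightarrow> complex \<Rightarrow> complex \<Rightarrow> complex \<Rightarrow> complex \<Rightarrow> complex \<Rightarrow> int \<Rightarrow> complex" where
  "somos4_seq A B z0 z g2 g3 n =
     A * B powi n * weierstrass_sigma (z0 + of_int n * z) g2 g3
       / weierstrass_sigma z g2 g3 powi (n\<^sup>2)"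

definition dual_somos4_seq ::
    "dual \<Rightarrow> dual \<Rightarrow> dual \<Rightarrow> dual \<Rightarrow> dual \<Rightarrow> dual \<Rightarrow> int \<Rightarrow> dual" where
  "dual_somos4_seq A B Z0 Z G2 G3 n =
     A * B powi n * dual_sigma (Z0 + of_int n * Z) G2 G3
       / dual_sigma Z G2 G3 powi (n\<^sup>2)"

end

theory Submission
  imports Defs
begin

text \<open>
  Everything rests on two facts about \<open>\<sigma>(z; g2, g3)\<close>: it is jointly holomorphic in its three
  arguments, and it satisfies the addition formula
  \<open>\<sigma>(u + v) \<sigma>(u - v) = \<sigma>(u)\<^sup>2 P(v) - \<sigma>(v)\<^sup>2 P(u)\<close> with \<open>P = \<sigma>\<^sup>2 \<wp>\<close>.  Three instances of
  the latter eliminate \<open>P\<close> and give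
  \<open>\<sigma>(z)\<^sup>2 \<sigma>(w + 2z) \<sigma>(w - 2z) = \<sigma>(2z)\<^sup>2 \<sigma>(w + z) \<sigma>(w - z) - \<sigma>(w)\<^sup>2 \<sigma>(3z) \<sigma>(z)\<close>,
  which is the Somos-4 relation up to powers of \<open>\<sigma>(z)\<close>.  By joint holomorphy a dual evaluation is
  the first-order jet of \<open>\<sigma>\<close> along a complex line in parameter space, so the identity passes to
  dual numbers.

  The sigma function of a possibly singular curve is built without lattices.  Near \<open>z = 0\<close> the
  Laurent series of \<open>\<wp>\<close> is given by the recurrence for its coefficients \<open>c\<^sub>n(g2, g3)\<close>, and the
  weights \<open>c\<^sub>n(t\<^sup>4 g2, t\<^sup>6 g3) = t\<^bsup>2n\<^esup> c\<^sub>n(g2, g3)\<close> turn it into a series in the two variables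
  \<open>z\<^sup>4 g2\<close>, \<open>z\<^sup>6 g3\<close>.  The differential equation of \<open>\<wp>\<close> yields the addition formula near \<open>0\<close>,
  hence duplication formulas that are polynomial in \<open>\<sigma>\<close>, \<open>\<sigma>\<^sup>2 \<wp>\<close>, \<open>\<sigma>\<^sup>3 \<wp>'\<close>.  Iterating these
  extends \<open>\<sigma>\<close> to an entire function and preserves joint holomorphy.
\<close>

section \<open>The Laurent coefficients of the Weierstrass function\<close>

text \<open>
  \<open>\<wp>(z) = z\<^bsup>-2\<^esup> + (\<Sum>n\<ge>2. c\<^sub>n z\<^bsup>2n-2\<^esup>)\<close>; the recurrence is the coefficient form of
  \<open>\<wp>'' = 6 \<wp>\<^sup>2 - g2/2\<close>, where \<open>c\<^sub>3\<close> is free;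
  \<open>c\<^sub>3 = g3/28\<close> selects the constant \<open>g3\<close> of the first-order equation.
\<close>

fun wp_coeff :: "complex \<Rightarrow> complex \<Rightarrow> nat \<Rightarrow> complex" where
  "wp_coeff x y n =
     (if n < 2 then 0 else if n = 2 then x / 20 else if n = 3 then y / 28
      else 3 / ((2 * of_nat n + 1) * (of_nat n - 3)) *
        (\<Sum>m=2..n-2. wp_coeff x y m * wp_coeff x y (n - m)))"

declare wp_coeff.simps [simp del]

lemma wp_coeff_small [simp]:
  "n < 2 \<Longrightarrow> wp_coeff x y n = 0" "wp_coeff x y 2 = x / 20" "wp_coeff x y 3 = y / 28"
  by (simp_all add: wp_coeff.simps)

lemma wp_coeff_rec:
  "n \<ge> 4 \<Longrightarrow> wp_coeff x y n = 3 / ((2 * of_nat n + 1) * (of_nat n - 3)) *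
     (\<Sum>m=2..n-2. wp_coeff x y m * wp_coeff x y (n - m))"
  by (subst wp_coeff.simps) simp

text \<open>The directional derivative of the coefficients at \<open>(x, y)\<close> along
  \<open>(h, k)\<close>, obtained by differentiating the recurrence. As a recursion of the same
  shape it can be bounded by the same induction as \<open>wp_coeff\<close>.\<close>

fun wp_coeff_deriv :: "complex \<Rightarrow> complex \<Rightarrow> complex \<Rightarrow> complex \<Rightarrow> nat \<Rightarrow> complex" where
  "wp_coeff_deriv x y h k n =
     (if n < 2 then 0 else if n = 2 then h / 20 else if n = 3 then k / 28
      else 3 / ((2 * of_nat n + 1) * (of_nat n - 3)) *
        (\<Sum>m=2..n-2. wp_coeff x y m * wp_coeff_deriv x y h k (n - m)
           + wp_coeff_deriv x y h k m * wp_coeff x y (n - m)))"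

declare wp_coeff_deriv.simps [simp del]

lemma wp_coeff_deriv_small [simp]:
  "n < 2 \<Longrightarrow> wp_coeff_deriv x y h k n = 0"
  "wp_coeff_deriv x y h k 2 = h / 20" "wp_coeff_deriv x y h k 3 = k / 28"
  by (simp_all add: wp_coeff_deriv.simps)

lemma wp_coeff_deriv_rec:
  "n \<ge> 4 \<Longrightarrow> wp_coeff_deriv x y h k n = 3 / ((2 * of_nat n + 1) * (of_nat n - 3)) *
     (\<Sum>m=2..n-2. wp_coeff x y m * wp_coeff_deriv x y h k (n - m)
        + wp_coeff_deriv x y h k m * wp_coeff x y (n - m))"
  by (subst wp_coeff_deriv.simps) simp

section \<open>Geometric bounds for the coefficients and their derivatives\<close>

text \<open>The sum has n - 3 terms, which cancels the factor n - 3 of the denominator; what is left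
  is 3 / (2n + 1), at most 1/3 for n >= 4. The gain of 1/2 will absorb the two summands of the
  product rule.\<close>

lemma norm_convolution_le:
  fixes f :: "nat \<Rightarrow> complex"
  assumes "n \<ge> 4" and "\<And>m. m \<in> {2..n-2} \<Longrightarrow> norm (f m) \<le> K"
  shows "norm (3 / ((2 * of_nat n + 1) * (of_nat n - 3)) * (\<Sum>m=2..n-2. f m)) \<le> K / 2"
proof -
  have K: "K \<ge> 0"
    using order_trans[OF norm_ge_zero assms(2)[of 2]] assms(1) by simp
  have "norm (\<Sum>m=2..n-2. f m) \<le> (\<Sum>m=2..n-2. K)"
    by (intro sum_norm_le assms(2))
  also have "\<dots> = (real n - 3) * K"
    using assms(1) by (simp add: of_nat_diff)
  finally have s: "norm (\<Sum>m=2..n-2. f m) \<le> (real n - 3) * K" .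
  have "norm ((2 * of_nat n + 1) * (of_nat n - 3) :: complex) = (2 * real n + 1) * (real n - 3)"
  proof -
    have "(2 * of_nat n + 1) * (of_nat n - 3) = (of_real ((2 * real n + 1) * (real n - 3)) :: complex)"
      by simp
    then show ?thesis
      using assms(1) by (simp only: norm_of_real) simp
  qed
  then have "norm (3 / ((2 * of_nat n + 1) * (of_nat n - 3)) * (\<Sum>m=2..n-2. f m))
      = 3 / ((2 * real n + 1) * (real n - 3)) * norm (\<Sum>m=2..n-2. f m)"
    by (simp add: norm_mult norm_divide)
  also have "\<dots> \<le> 3 / ((2 * real n + 1) * (real n - 3)) * ((real n - 3) * K)"
    using assms(1) by (intro mult_left_mono s) auto
  also have "\<dots> = 3 / (2 * real n + 1) * K"
    using assms(1) by (simp add: divide_simps)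
  also have "\<dots> \<le> 1 / 2 * K"
    using assms(1) K by (intro mult_right_mono) (auto simp: divide_simps)
  finally show ?thesis by simp
qed

text \<open>In each product of the convolution the indices add up to n, so geometric bounds
  reproduce themselves. The start values hold because 1/20 <= 1/4 and 1/28 <= 1/8.\<close>

lemma norm_wp_coeff_le:
  assumes "norm x \<le> 1" "norm y \<le> 1"
  shows "norm (wp_coeff x y n) \<le> (1/2) ^ n"
proof (induction n rule: less_induct)
  case (less n)
  consider "n < 2" | "n = 2" | "n = 3" | "n \<ge> 4" by linarith
  then show ?case
  proof cases
    case 4
    have "norm (wp_coeff x y m * wp_coeff x y (n - m)) \<le> (1/2) ^ n" if "m \<in> {2..n-2}" for m
    proof -
      have "norm (wp_coeff x y m * wp_coeff x y (n - m)) \<le> (1/2) ^ m * (1/2) ^ (n - m)"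
        unfolding norm_mult using that 4 by (intro mult_mono less) auto
      moreover have "m + (n - m) = n" using that 4 by auto
      ultimately show ?thesis by (simp flip: power_add)
    qed
    then have "norm (wp_coeff x y n) \<le> (1/2) ^ n / 2"
      unfolding wp_coeff_rec[OF 4] by (intro norm_convolution_le[OF 4])
    also have "\<dots> \<le> (1/2) ^ n" by simp
    finally show ?thesis .
  qed (use assms in \<open>auto simp: norm_divide power2_eq_square power3_eq_cube\<close>)
qed

text \<open>The product rule doubles the number of terms, and the factor 1/2 of
  \<open>norm_convolution_le\<close> makes up for exactly that.\<close>

lemma norm_wp_coeff_deriv_le:
  assumes "norm x \<le> 1" "norm y \<le> 1"
  shows "norm (wp_coeff_deriv x y h k n) \<le> (1/2) ^ n * norm (h, k)"
proof (induction n rule: less_induct)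
  case (less n)
  have hk: "norm h \<le> norm (h, k)" "norm k \<le> norm (h, k)"
    by (simp_all add: norm_Pair real_le_rsqrt)
  consider "n < 2" | "n = 2" | "n = 3" | "n \<ge> 4" by linarith
  then show ?case
  proof cases
    case 4
    have "norm (wp_coeff x y m * wp_coeff_deriv x y h k (n - m)
        + wp_coeff_deriv x y h k m * wp_coeff x y (n - m)) \<le> 2 * ((1/2) ^ n * norm (h, k))"
      if "m \<in> {2..n-2}" for m
    proof -
      have "norm (wp_coeff x y m * wp_coeff_deriv x y h k (n - m)) 
          \<le> (1/2) ^ m * ((1/2) ^ (n - m) * norm (h, k))"
        unfolding norm_mult using that 4 
        by (intro mult_mono less norm_wp_coeff_le assms) auto
      moreover have "norm (wp_coeff_deriv x y h k m * wp_coeff x y (n - m)) 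
          \<le> ((1/2) ^ m * norm (h, k)) * (1/2) ^ (n - m)"
        unfolding norm_mult using that 4 
        by (intro mult_mono less norm_wp_coeff_le assms) auto
      moreover have mn: "m + (n - m) = n" using that 4 by auto
      have "(1/2::real) ^ m * (1/2) ^ (n - m) = (1/2) ^ n"
        unfolding power_add[symmetric] mn ..
      then have "(1/2) ^ m * ((1/2) ^ (n - m) * norm (h, k)) = (1/2) ^ n * norm (h, k)"
        "((1/2) ^ m * norm (h, k)) * (1/2) ^ (n - m) = (1/2) ^ n * norm (h, k)"
        by (simp_all add: mult_ac)
      ultimately show ?thesis
        by (intro norm_triangle_le) simp
    qed
    then have "norm (wp_coeff_deriv x y h k n) \<le> 2 * ((1/2) ^ n * norm (h, k)) / 2"
      unfolding wp_coeff_deriv_rec[OF 4] by (intro norm_convolution_le[OF 4])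
    then show ?thesis by simp
  next
    case 2
    have "norm h / 20 \<le> (1/2)\<^sup>2 * norm (h, k)"
      using hk(1) norm_ge_zero[of h] unfolding power2_eq_square by linarith
    then show ?thesis using 2 by (simp add: norm_divide)
  next
    case 3
    have "norm k / 28 \<le> (1/2)^3 * norm (h, k)"
      using hk(2) norm_ge_zero[of k] unfolding power3_eq_cube by linarith
    then show ?thesis using 3 by (simp add: norm_divide)
  qed simp
qed

section \<open>Weights and differentiability in the invariants\<close>

text \<open>Give x weight 4 and y weight 6: the start values then have weights 4 and 6, and the
  convolution adds weights. This lets powers of z be moved into the invariants.\<close>

lemma wp_coeff_homogeneous: "wp_coeff (t^4 * x) (t^6 * y) n = (t\<^sup>2) ^ n * wp_coeff x y n"
proof (induction n rule: less_induct)
  case (less n)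
  consider "n < 2" | "n = 2" | "n = 3" | "n \<ge> 4" by linarith
  then show ?case
  proof cases
    case 4
    have "(\<Sum>m=2..n-2. wp_coeff (t^4*x) (t^6*y) m * wp_coeff (t^4*x) (t^6*y) (n - m))
        = (\<Sum>m=2..n-2. (t\<^sup>2) ^ n * (wp_coeff x y m * wp_coeff x y (n - m)))"
    proof (intro sum.cong refl)
      fix m assume m: "m \<in> {2..n-2}"
      have "m + (n - m) = n" using m 4 by auto
      then have "(t\<^sup>2) ^ n = (t\<^sup>2) ^ m * (t\<^sup>2) ^ (n - m)"
        by (simp flip: power_add)
      then show "wp_coeff (t^4*x) (t^6*y) m * wp_coeff (t^4*x) (t^6*y) (n - m) =
          (t\<^sup>2) ^ n * (wp_coeff x y m * wp_coeff x y (n - m))"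
        using less[of m] less[of "n - m"] m 4 by fastforce
    qed
    then show ?thesis
      unfolding wp_coeff_rec[OF 4] by (simp flip: sum_distrib_left)
  qed (auto simp flip: power_mult)
qed

text \<open>A Frechet derivative is only real-linear a priori. Compatibility with complex scalars is
  what later turns the derivative of the series into a complex-linear map.\<close>

lemma wp_coeff_deriv_homogeneous:
  "wp_coeff_deriv x y (t * h) (t * k) n = t * wp_coeff_deriv x y h k n"
proof (induction n rule: less_induct)
  case (less n)
  consider "n < 2" | "n = 2" | "n = 3" | "n \<ge> 4" by linarith
  then show ?case
  proof cases
    case 4
    have "(\<Sum>m=2..n-2. wp_coeff x y m * wp_coeff_deriv x y (t * h) (t * k) (n - m)
           + wp_coeff_deriv x y (t * h) (t * k) m * wp_coeff x y (n - m))
        = (\<Sum>m=2..n-2. t * (wp_coeff x y m * wp_coeff_deriv x y h k (n - m)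
           + wp_coeff_deriv x y h k m * wp_coeff x y (n - m)))"
    proof (intro sum.cong refl)
      fix m assume "m \<in> {2..n-2}"
      then have "m < n" "n - m < n" using 4 by auto
      then show "wp_coeff x y m * wp_coeff_deriv x y (t * h) (t * k) (n - m)
           + wp_coeff_deriv x y (t * h) (t * k) m * wp_coeff x y (n - m)
        = t * (wp_coeff x y m * wp_coeff_deriv x y h k (n - m)
           + wp_coeff_deriv x y h k m * wp_coeff x y (n - m))"
        by (simp add: less distrib_left mult.left_commute)
    qed
    then show ?thesis
      unfolding wp_coeff_deriv_rec[OF 4] by (simp flip: sum_distrib_left)
  qed auto
qed

lemma has_derivative_wp_coeff:
  "((\<lambda>(x, y). wp_coeff x y n) has_derivative (\<lambda>(h, k). wp_coeff_deriv x y h k n))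
     (at (x, y) within S)"
proof (induction n rule: less_induct)
  case (less n)
  consider "n < 2" | "n = 2" | "n = 3" | "n \<ge> 4" by linarith
  then show ?case
  proof cases
    case 2
    then show ?thesis
      by (simp add: case_prod_beta) (auto intro!: derivative_eq_intros)
  next
    case 3
    then show ?thesis
      by (simp add: case_prod_beta) (auto intro!: derivative_eq_intros)
  next
    case 4
    let ?C = "3 / ((2 * of_nat n + 1) * (of_nat n - 3)) :: complex"
    have IH: "((\<lambda>p. wp_coeff (fst p) (snd p) m) has_derivative
        (\<lambda>v. wp_coeff_deriv x y (fst v) (snd v) m)) (at (x, y) within S)" if "m < n" for m
      using less[OF that] unfolding case_prod_beta .
    have "((\<lambda>p. wp_coeff (fst p) (snd p) m * wp_coeff (fst p) (snd p) (n - m)) has_derivative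
        (\<lambda>v. wp_coeff x y m * wp_coeff_deriv x y (fst v) (snd v) (n - m)
           + wp_coeff_deriv x y (fst v) (snd v) m * wp_coeff x y (n - m))) (at (x, y) within S)"
      if "m \<in> {2..n-2}" for m
    proof -
      have "m < n" "n - m < n" using that 4 by auto
      from has_derivative_mult[OF IH[OF this(1)] IH[OF this(2)]] show ?thesis
        unfolding fst_conv snd_conv .
    qed
    then have "((\<lambda>p. ?C * (\<Sum>m=2..n-2. wp_coeff (fst p) (snd p) m * wp_coeff (fst p) (snd p) (n - m)))
      has_derivative (\<lambda>v. ?C * (\<Sum>m=2..n-2. wp_coeff x y m * wp_coeff_deriv x y (fst v) (snd v) (n - m)
           + wp_coeff_deriv x y (fst v) (snd v) m * wp_coeff x y (n - m)))) (at (x, y) within S)"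
      by (intro has_derivative_mult_right has_derivative_sum)
    then show ?thesis
      unfolding wp_coeff_rec[OF 4] wp_coeff_deriv_rec[OF 4] case_prod_beta .
  next
    case 1
    then show ?thesis by (simp only: wp_coeff_small wp_coeff_deriv_small case_prod_beta) simp
  qed
qed

section \<open>The weighted series in the scaled invariants\<close>

text \<open>At x = z^4 g2, y = z^6 g3 this is the sum of w n c_n(g2, g3) z^(2n), by homogeneity. In
  this form z enters only through x and y, so one domain, the unit bidisc, serves for all
  curves.\<close>

definition wp_series :: "(nat \<Rightarrow> complex) \<Rightarrow> complex \<Rightarrow> complex \<Rightarrow> complex" where
  "wp_series w x y = (\<Sum>n. w n * wp_coeff x y n)"

lemma summable_linear_times_geometric: "summable (\<lambda>n. 2 * real (Suc n) * (1/2) ^ n)"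
  using sums_summable[OF geometric_deriv_sums[of "1/2::real"]]
  by (simp only: mult.assoc summable_mult) simp

text \<open>Termwise differentiation: on the unit bidisc the terms and their derivatives are
  dominated by the summable sequence 2 (n + 1) / 2^n.\<close>

lemma has_derivative_wp_series:
  assumes w: "\<And>n. norm (w n) \<le> 2 * real (Suc n)" and xy: "norm x < 1" "norm y < 1"
  obtains a b where "((\<lambda>(x, y). wp_series w x y) has_derivative (\<lambda>(h, k). a * h + b * k)) (at (x, y))"
proof -
  define S :: "(complex \<times> complex) set" where "S = ball 0 1 \<times> ball 0 1"
  define f where "f n p = w n * wp_coeff (fst p) (snd p) n" for n p
  define f' where "f' n p v = w n * wp_coeff_deriv (fst p) (snd p) (fst v) (snd v) n" for n p v
  define M where "M n = 2 * real (Suc n) * (1/2) ^ n" for n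
  have S: "norm (fst p) \<le> 1" "norm (snd p) \<le> 1" if "p \<in> S" for p
    using that by (auto simp: S_def)
  have xyS: "(x, y) \<in> S"
    using xy by (simp add: S_def)
  have "open S" "convex S"
    by (auto simp: S_def intro!: open_Times convex_Times)
  have M: "summable M"
    unfolding M_def by (rule summable_linear_times_geometric)
  have f_le: "norm (f n p) \<le> M n" if "p \<in> S" for n p
    unfolding f_def M_def norm_mult using S[OF that]
    by (intro mult_mono w norm_wp_coeff_le) auto
  have f'_le: "norm (f' n p v) \<le> M n * norm v" if "p \<in> S" for n p v
  proof -
    have "norm (f' n p v) \<le> (2 * real (Suc n)) * ((1/2) ^ n * norm (fst v, snd v))"
      unfolding f'_def norm_mult using S[OF that]
      by (intro mult_mono w norm_wp_coeff_deriv_le) auto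
    then show ?thesis by (simp add: M_def mult_ac)
  qed
  have f'_summable: "summable (\<lambda>n. f' n p v)" if "p \<in> S" for p v
    by (rule summable_comparison_test'[OF summable_mult2[OF M]]) (rule f'_le[OF that])
  have "\<forall>\<^sub>F n in sequentially. \<forall>p\<in>S. \<forall>v. norm ((\<Sum>i<n. f' i p v) - (\<Sum>i. f' i p v)) \<le> e * norm v"
    if "e > 0" for e
  proof -
    \<comment> \<open>Tails of the majorant control the tails of the derivative series uniformly in
      the base point \<open>p\<close>, which is the hypothesis of
      \<open>has_derivative_series\<close>.\<close>
    obtain N where N: "\<And>n. n \<ge> N \<Longrightarrow> norm (\<Sum>i. M (i + n)) < e"
      using suminf_exist_split[OF \<open>e > 0\<close> M] by blast
    have "norm ((\<Sum>i<n. f' i p v) - (\<Sum>i. f' i p v)) \<le> e * norm v" if "n \<ge> N" "p \<in> S" for n p v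
    proof -
      have "norm ((\<Sum>i<n. f' i p v) - (\<Sum>i. f' i p v)) = norm (\<Sum>i. f' (i + n) p v)"
        using suminf_split_initial_segment[OF f'_summable[OF that(2)], of v n]
        by (simp add: norm_minus_commute)
      also have "\<dots> \<le> (\<Sum>i. M (i + n) * norm v)"
        using f'_le[OF that(2)] M by (intro norm_suminf_le summable_mult2) (auto simp: summable_iff_shift)
      also have "\<dots> = (\<Sum>i. M (i + n)) * norm v"
        using M by (intro suminf_mult2[symmetric]) (simp add: summable_iff_shift)
      also have "\<dots> \<le> e * norm v"
        using N[OF that(1)] by (intro mult_right_mono) auto
      finally show ?thesis .
    qed
    then show ?thesis
      unfolding eventually_sequentially by blast
  qed
  moreover have "(f n has_derivative f' n p) (at p within S)" for n p
  proof -
    have "((\<lambda>p. wp_coeff (fst p) (snd p) n) has_derivative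
        (\<lambda>v. wp_coeff_deriv (fst p) (snd p) (fst v) (snd v) n)) (at p within S)"
      using has_derivative_wp_coeff[of n "fst p" "snd p" S] unfolding case_prod_beta prod.collapse .
    then show ?thesis
      unfolding f_def f'_def by (rule has_derivative_mult_right)
  qed
  moreover have "(\<lambda>n. f n (x, y)) sums (\<Sum>n. f n (x, y))"
    by (intro summable_sums summable_comparison_test'[OF M f_le[OF xyS]])
  ultimately have "\<exists>g. \<forall>p\<in>S. (\<lambda>n. f n p) sums g p
      \<and> (g has_derivative (\<lambda>v. \<Sum>i. f' i p v)) (at p within S)"
    by (intro has_derivative_series[OF \<open>convex S\<close> _ _ xyS])
  then obtain g where g: "\<And>p. p \<in> S \<Longrightarrow> (\<lambda>n. f n p) sums g p"
      "\<And>p. p \<in> S \<Longrightarrow> (g has_derivative (\<lambda>v. \<Sum>i. f' i p v)) (at p within S)"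
    by blast
  have g_eq: "g p = wp_series w (fst p) (snd p)" if "p \<in> S" for p
    using sums_unique[OF g(1)[OF that]] by (simp add: wp_series_def f_def)
  define D where "D v = (\<Sum>i. f' i (x, y) v)" for v
  have D: "((\<lambda>(x, y). wp_series w x y) has_derivative D) (at (x, y))"
  proof (rule has_derivative_transform_within_open[OF _ \<open>open S\<close> xyS])
    show "(g has_derivative D) (at (x, y))"
      using g(2)[OF xyS] unfolding D_def at_within_open[OF xyS \<open>open S\<close>] .
  qed (simp add: g_eq case_prod_beta)
  \<comment> \<open>With additivity of \<open>D\<close>, complex homogeneity on each coordinate
    yields the form a h + b k.\<close>
  have scale: "D (t * h, t * k) = t * D (h, k)" for t h k
    using suminf_mult[OF f'_summable[OF xyS, of "(h, k)"], of t]
    by (simp add: D_def f'_def wp_coeff_deriv_homogeneous mult.left_commute)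
  define a b where "a = D (1, 0)" and "b = D (0, 1)"
  have "D (h, k) = a * h + b * k" for h k
  proof -
    have "D (h, k) = D ((h, 0) + (0, k))" by simp
    also have "\<dots> = D (h, 0) + D (0, k)"
      by (intro linear_add has_derivative_linear[OF D])
    finally show ?thesis
      using scale[of h 1 0] scale[of k 0 1] by (simp add: a_def b_def mult.commute)
  qed
  then have "D = (\<lambda>(h, k). a * h + b * k)"
    by auto
  with D that show ?thesis by simp
qed

section \<open>Addition and duplication formulas near the origin\<close>

lemma holomorphic_eq_if_eq_on_punctured_ball:
  fixes f g :: "complex \<Rightarrow> complex"
  assumes "f holomorphic_on ball a d" "g holomorphic_on ball a d"
    and eq: "\<And>u. u \<in> ball a d \<Longrightarrow> u \<noteq> a \<Longrightarrow> f u = g u" and u: "u \<in> ball a d"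
  shows "f u = g u"
proof -
  have "d > 0"
    using zero_le_dist[of a u] u unfolding mem_ball by (rule le_less_trans)
  then have "a + of_real (d / 2) \<in> ball a d - {a}"
    by (simp add: dist_norm)
  then have ne: "ball a d - {a} \<noteq> {}" by blast
  show ?thesis
    by (rule analytic_continuation_open[of "ball a d - {a}" "ball a d" f g])
      (use assms ne in auto)
qed

text \<open>Near a the quotient f / g is holomorphic with zero derivative, hence constant; the
  identity theorem carries the proportionality to all of S. The Wronskian condition is asked only
  off a because in the applications the derivatives are computed from expressions with a pole at
  a.\<close>

lemma proportional_if_wronskian_zero:
  fixes f g :: "complex \<Rightarrow> complex"
  assumes f: "f holomorphic_on S" and g: "g holomorphic_on S"
    and S: "open S" "connected S" "a \<in> S" and nz: "g a \<noteq> 0"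
    and W: "\<And>u. u \<in> S \<Longrightarrow> u \<noteq> a \<Longrightarrow> deriv f u * g u = f u * deriv g u"
    and u: "u \<in> S"
  shows "f u * g a = f a * g u"
proof -
  have "open (S \<inter> g -` (- {0}))"
    using g S(1) by (intro continuous_open_preimage holomorphic_on_imp_continuous_on) auto
  then obtain d where d: "d > 0" "ball a d \<subseteq> S \<inter> g -` (- {0})"
    using S(3) nz by (auto elim!: openE)
  have wr: "deriv f u * g u - f u * deriv g u = 0" if "u \<in> ball a d" for u
  proof (rule holomorphic_eq_if_eq_on_punctured_ball[OF _ _ _ that])
    show "(\<lambda>u. deriv f u * g u - f u * deriv g u) holomorphic_on ball a d"
      using d(2) by (intro holomorphic_intros holomorphic_on_subset[OF f] holomorphic_on_subset[OF g]
          holomorphic_on_subset[OF holomorphic_deriv[OF f S(1)]]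
          holomorphic_on_subset[OF holomorphic_deriv[OF g S(1)]]) auto
    show "deriv f z * g z - f z * deriv g z = 0" if "z \<in> ball a d" "z \<noteq> a" for z
      using that d(2) W by auto
  qed auto
  have "\<exists>c. \<forall>u\<in>ball a d. f u / g u = c"
  proof (rule has_field_derivative_zero_constant)
    fix u assume u: "u \<in> ball a d"
    then have "u \<in> S" "g u \<noteq> 0" using d(2) by auto
    then have "((\<lambda>u. f u / g u) has_field_derivative
        (deriv f u * g u - f u * deriv g u) / (g u * g u)) (at u)"
      using f g S(1) by (intro DERIV_divide holomorphic_derivI) auto
    then show "((\<lambda>u. f u / g u) has_field_derivative 0) (at u within ball a d)"
      using wr[OF u] by (simp add: has_field_derivative_at_within)
  qed auto
  then obtain c where c: "\<And>u. u \<in> ball a d \<Longrightarrow> f u / g u = c" by blast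
  have nz': "g u \<noteq> 0" if "u \<in> ball a d" for u
    using that d(2) by auto
  have "c = f a / g a" using c[of a] d(1) by simp
  then have eq: "f u * g a = f a * g u" if "u \<in> ball a d" for u
    using c[OF that] nz'[OF that] nz by (simp add: field_simps)
  show ?thesis
    by (rule analytic_continuation_open[where s = "ball a d" and s' = S and f = "\<lambda>u. f u * g a"])
      (use d S u eq f g in \<open>auto intro!: holomorphic_intros\<close>)
qed

lemma DERIV_affine:
  fixes f :: "complex \<Rightarrow> complex"
  assumes "(f has_field_derivative d) (at (b + a * t))"
  shows "((\<lambda>t. f (b + a * t)) has_field_derivative d * a) (at t)"
proof -
  have "((\<lambda>t. b + a * t) has_field_derivative a) (at t)"
    by (auto intro!: derivative_eq_intros)
  then show ?thesis
    using DERIV_chain2[where f = f and g = "\<lambda>t. b + a * t" and x = t, OF assms] by blast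
qed

text \<open>
  Here \<open>e\<close> is the regular part of the zeta function, \<open>\<zeta> = s'/s = 1/z - e\<close>, so that
  \<open>\<wp> = -\<zeta>' = 1/z\<^sup>2 + e'\<close>.
\<close>

locale sigma_germ =
  fixes r :: real and g2 g3 :: complex and s e :: "complex \<Rightarrow> complex"
  assumes s_holo: "s holomorphic_on ball 0 r" and e_holo: "e holomorphic_on ball 0 r"
    and s_0: "s 0 = 0" and deriv_s_0: "deriv s 0 = 1" and e_0: "e 0 = 0"
    and s_odd: "\<And>z. z \<in> ball 0 r \<Longrightarrow> s (- z) = - s z"
    and e_odd: "\<And>z. z \<in> ball 0 r \<Longrightarrow> e (- z) = - e z"
    and s_nonzero: "\<And>z. z \<in> ball 0 r - {0} \<Longrightarrow> s z \<noteq> 0"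
    and deriv_s: "\<And>z. z \<in> ball 0 r - {0} \<Longrightarrow> deriv s z = (1 / z - e z) * s z"
    and ode_first: "\<And>z. z \<in> ball 0 r - {0} \<Longrightarrow>
      (deriv (deriv e) z - 2 / z ^ 3)\<^sup>2
        = 4 * (deriv e z + 1 / z\<^sup>2) ^ 3 - g2 * (deriv e z + 1 / z\<^sup>2) - g3"
    and ode_second: "\<And>z. z \<in> ball 0 r - {0} \<Longrightarrow>
      deriv (deriv (deriv e)) z + 6 / z ^ 4 = 6 * (deriv e z + 1 / z\<^sup>2)\<^sup>2 - g2 / 2"
begin

definition \<zeta> where "\<zeta> z = 1 / z - e z"
definition wp where "wp z = deriv e z + 1 / z\<^sup>2"
definition wp' where "wp' z = deriv (deriv e) z - 2 / z ^ 3"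

section \<open>Derivatives and parity of the germ functions\<close>

lemma e_derivs_holo:
  "deriv e holomorphic_on ball 0 r" "deriv (deriv e) holomorphic_on ball 0 r"
  by (intro holomorphic_deriv e_holo open_ball)+

lemma zeta_deriv: "z \<in> ball 0 r - {0} \<Longrightarrow> (\<zeta> has_field_derivative - wp z) (at z)"
  unfolding \<zeta>_def wp_def
  by (rule derivative_eq_intros holomorphic_derivI[OF e_holo] refl | force simp: field_simps power2_eq_square)+

lemma wp_deriv: "z \<in> ball 0 r - {0} \<Longrightarrow> (wp has_field_derivative wp' z) (at z)"
  unfolding wp_def wp'_def
  by (auto intro!: derivative_eq_intros holomorphic_derivI[OF e_derivs_holo(1)]
      simp: field_simps eval_nat_numeral)

lemma wp'_deriv:
  assumes "z \<in> ball 0 r - {0}"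
  shows "(wp' has_field_derivative 6 * (wp z)\<^sup>2 - g2 / 2) (at z)"
  unfolding wp_def ode_second[OF assms, symmetric] wp'_def using assms
  by (auto intro!: derivative_eq_intros holomorphic_derivI[OF e_derivs_holo(2)]
      simp: field_simps eval_nat_numeral)

lemma s_has_deriv_at: "z \<in> ball 0 r \<Longrightarrow> (s has_field_derivative deriv s z) (at z)"
  by (rule holomorphic_derivI[OF s_holo open_ball])

lemma s_has_deriv: "z \<in> ball 0 r - {0} \<Longrightarrow> (s has_field_derivative \<zeta> z * s z) (at z)"
  using holomorphic_derivI[OF s_holo, of z] deriv_s[of z] by (simp add: \<zeta>_def)

lemma wp'_squared: "z \<in> ball 0 r - {0} \<Longrightarrow> (wp' z)\<^sup>2 = 4 * wp z ^ 3 - g2 * wp z - g3"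
  unfolding wp_def wp'_def by (rule ode_first)

text \<open>The factor c is -1 for an odd and 1 for an even function; differentiation reverses the
  parity.\<close>

lemma deriv_odd: 
  assumes f: "f holomorphic_on ball 0 r" and "\<And>z. z \<in> ball 0 r \<Longrightarrow> f (- z) = c * f z"
    and z: "z \<in> ball 0 r" 
  shows "deriv f (- z) = - c * deriv f z"
proof -
  have "((\<lambda>z. f (- z)) has_field_derivative deriv f (- z) * - 1) (at z)"
    using z by (intro DERIV_chain2[of f _ "uminus"] holomorphic_derivI[OF f])
      (auto intro!: derivative_eq_intros)
  moreover have "((\<lambda>z. f (- z)) has_field_derivative c * deriv f z) (at z)"
    by (rule has_field_derivative_transform_within_open[OF DERIV_cmult[OF holomorphic_derivI[OF f]]
        open_ball z]) (use z assms(2) in auto)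
  ultimately have "deriv f (- z) * - 1 = c * deriv f z"
    by (rule DERIV_unique)
  then show ?thesis by (metis minus_minus mult_minus1_right mult_minus_left)
qed

lemma parity:
  assumes "z \<in> ball 0 r"
  shows "\<zeta> (- z) = - \<zeta> z" "wp (- z) = wp z" "wp' (- z) = - wp' z"
proof -
  have 1: "deriv e (- z) = 1 * deriv e z" if "z \<in> ball 0 r" for z
    using deriv_odd[OF e_holo, of "-1" z] e_odd that by simp
  have 2: "deriv (deriv e) (- z) = - 1 * deriv (deriv e) z"
    by (rule deriv_odd[OF e_derivs_holo(1) 1 assms])
  show "\<zeta> (- z) = - \<zeta> z" "wp (- z) = wp z" "wp' (- z) = - wp' z"
    using e_odd[OF assms] 1[OF assms] 2 by (simp_all add: \<zeta>_def wp_def wp'_def)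
qed


text \<open>
  For fixed \<open>c = u + v\<close>, the left-hand side below, as a function of \<open>u\<close>, satisfies the same
  first-order linear equation as \<open>\<wp>(u) - \<wp>(c - u)\<close>.  Clearing the double pole at \<open>u = 0\<close>, it vanishes
  there whereas \<open>u\<^sup>2 (\<wp>(u) - \<wp>(c - u))\<close> does not.
\<close>

lemma zeta_addition:
  assumes u: "u \<in> ball 0 r - {0}" and v: "v \<in> ball 0 r - {0}" and uv: "u + v \<in> ball 0 r - {0}"
  shows "2 * (\<zeta> u + \<zeta> v - \<zeta> (u + v)) * (wp u - wp v) + wp' u - wp' v = 0"
proof -
  define c where "c = u + v"
  \<comment> \<open>Both t and c - t must lie in the disc, and t = c is deleted because wp(c - t)
    has a pole there. The point t = 0 stays in S, since its poles are cleared below.\<close>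
  define S where "S = ball 0 r \<inter> ball c r - {c}"
  \<comment> \<open>\<open>k\<close> is the regular part at 0 of zeta(t) + zeta(c - t) - zeta(c),
    the polar part being 1/t. Expanding t^2 times the left-hand side, the contributions 2/t and -2/t
    cancel, which leaves the holomorphic \<open>f\<close>; note that \<open>k 0 = 0\<close>.\<close>
  define k where "k t = \<zeta> (c - t) - \<zeta> c - e t" for t
  define g where "g t = 1 + t\<^sup>2 * (deriv e t - wp (c - t))" for t
  define f where "f t = 2 * t * (deriv e t - wp (c - t)) + 2 * k t * g t
      + t\<^sup>2 * (deriv (deriv e) t - wp' (c - t))" for t
  have c: "c \<in> ball 0 r - {0}" and r: "r > 0"
    using uv u by (auto simp: c_def intro: le_less_trans[OF norm_ge_zero])
  have "connected (ball 0 r \<inter> ball c r)"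
    by (intro convex_connected convex_Int convex_ball)
  then have "connected S"
    unfolding S_def by (intro connected_open_delete) (auto simp: open_Int)
  then have S: "open S" "connected S" "0 \<in> S" "u \<in> S"
    using c r u v dist_add_cancel[of u v 0] by (auto simp: S_def c_def dist_commute)
  have S_in: "t \<in> ball 0 r" "c - t \<in> ball 0 r - {0}" if "t \<in> S" for t
    using that by (auto simp: S_def dist_norm norm_minus_commute)
  have holo_e: "e holomorphic_on S" "deriv e holomorphic_on S" "deriv (deriv e) holomorphic_on S"
    using S_in(1) by (auto intro: holomorphic_on_subset[OF e_holo]
      holomorphic_on_subset[OF e_derivs_holo(1)] holomorphic_on_subset[OF e_derivs_holo(2)])
  have shift: "((\<lambda>t. \<zeta> (c - t)) has_field_derivative wp (c - t)) (at t)"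
    "((\<lambda>t. wp (c - t)) has_field_derivative - wp' (c - t)) (at t)"
    "((\<lambda>t. wp' (c - t)) has_field_derivative - (6 * (wp (c - t))\<^sup>2 - g2 / 2)) (at t)"
    if "t \<in> S" for t
    using DERIV_affine[of \<zeta> _ c "-1" t] DERIV_affine[of wp _ c "-1" t] DERIV_affine[of wp' _ c "-1" t]
      zeta_deriv[OF S_in(2)[OF that]] wp_deriv[OF S_in(2)[OF that]] wp'_deriv[OF S_in(2)[OF that]]
    by fastforce+
  then have holo_shift: "(\<lambda>t. \<zeta> (c - t)) holomorphic_on S" "(\<lambda>t. wp (c - t)) holomorphic_on S"
    "(\<lambda>t. wp' (c - t)) holomorphic_on S"
    using S(1) holomorphic_on_open by blast+
  have holo_g: "g holomorphic_on S"
    unfolding g_def by (intro holomorphic_intros holo_e holo_shift)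
  have holo_f: "f holomorphic_on S"
    unfolding f_def k_def by (intro holomorphic_intros holo_e holo_shift holo_g)
  define m where "m t = 2 * (\<zeta> t + \<zeta> (c - t) - \<zeta> c) * (wp t - wp (c - t)) + wp' t - wp' (c - t)" for t
  have g_eq: "g t = t\<^sup>2 * (wp t - wp (c - t))" if "t \<in> S - {0}" for t
    using that by (simp add: g_def wp_def field_simps power2_eq_square)
  have f_eq: "f t = t\<^sup>2 * m t" if "t \<in> S - {0}" for t
    using that
    by (simp add: f_def g_def k_def m_def wp_def[of t] wp'_def[of t] \<zeta>_def[of t] field_simps eval_nat_numeral)
  have W: "deriv f t * g t = f t * deriv g t" if t: "t \<in> S - {0}" for t
  proof -
    have t': "t \<in> ball 0 r - {0}" "t \<in> S" using t S_in(1) by auto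
    let ?a = "wp t" and ?b = "wp (c - t)" and ?a' = "wp' t" and ?b' = "wp' (c - t)"
    let ?h = "\<zeta> t + \<zeta> (c - t) - \<zeta> c"
    have "((\<lambda>t. t\<^sup>2 * (wp t - wp (c - t))) has_field_derivative
        2 * t * (?a - ?b) + t\<^sup>2 * (?a' + ?b')) (at t)"
      using shift[OF t'(2)] wp_deriv[OF t'(1)] by (auto intro!: derivative_eq_intros)
    then have "(g has_field_derivative 2 * t * (?a - ?b) + t\<^sup>2 * (?a' + ?b')) (at t)"
      by (rule has_field_derivative_transform_within_open[where S = "S - {0}"])
        (use S(1) t g_eq in \<open>auto intro!: open_Diff\<close>)
    then have dg: "deriv g t = 2 * t * (?a - ?b) + t\<^sup>2 * (?a' + ?b')"
      by (rule DERIV_imp_deriv)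
    define m' where "m' = 2 * (?b - ?a) * (?a - ?b) + 2 * ?h * (?a' + ?b')
      + (6 * ?a\<^sup>2 - g2 / 2) + (6 * ?b\<^sup>2 - g2 / 2)"
    have "(m has_field_derivative m') (at t)"
      unfolding m_def m'_def
      using shift[OF t'(2)] zeta_deriv[OF t'(1)] wp_deriv[OF t'(1)] wp'_deriv[OF t'(1)]
      by (auto intro!: derivative_eq_intros)
    then have "((\<lambda>t. t\<^sup>2 * m t) has_field_derivative 2 * t * m t + t\<^sup>2 * m') (at t)"
      by (auto intro!: derivative_eq_intros)
    then have "(f has_field_derivative 2 * t * m t + t\<^sup>2 * m') (at t)"
      by (rule has_field_derivative_transform_within_open[where S = "S - {0}"])
        (use S(1) t f_eq in \<open>auto intro!: open_Diff\<close>)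
    then have df: "deriv f t = 2 * t * m t + t\<^sup>2 * m'"
      by (rule DERIV_imp_deriv)
    have "?a'\<^sup>2 - ?b'\<^sup>2 = 4 * ?a ^ 3 - 4 * ?b ^ 3 - g2 * (?a - ?b)"
      unfolding wp'_squared[OF t'(1)] wp'_squared[OF S_in(2)[OF t'(2)]] by (simp add: algebra_simps)
    \<comment> \<open>The cubic difference factors through \<open>?a - ?b\<close> and matches the
      part of \<open>m'\<close> without \<open>?h\<close>. As \<open>?a' + ?b'\<close> is the
      derivative of wp(t) - wp(c - t), the two functions satisfy the same first-order linear
      equation.\<close>
    then have "m' * (?a - ?b) = m t * (?a' + ?b')"
      unfolding m'_def m_def by algebra
    then show ?thesis
      unfolding df dg g_eq[OF t] f_eq[OF t] by algebra
  qed
  have "f u * g 0 = f 0 * g u"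
    by (rule proportional_if_wronskian_zero[OF holo_f holo_g S(1-3)]) (use W S(4) in \<open>auto simp: g_def\<close>)
  then have "f u = 0"
    by (simp add: g_def f_def k_def e_0)
  then show ?thesis
    using f_eq[of u] S(4) u by (auto simp: m_def c_def)
qed

section \<open>The addition formula for the germ of sigma\<close>

text \<open>This is -(log s)'' times s^2, that is s^2 wp, written without division so that it is
  holomorphic at 0 as well.\<close>

definition p where "p z = (deriv s z)\<^sup>2 - s z * deriv (deriv s) z"

lemma p_holo: "p holomorphic_on ball 0 r"
  unfolding p_def by (intro holomorphic_intros s_holo holomorphic_deriv open_ball)

lemma p_eq:
  assumes z: "z \<in> ball 0 r - {0}"
  shows "p z = (s z)\<^sup>2 * wp z"
proof -
  have "((\<lambda>z. \<zeta> z * s z) has_field_derivative - wp z * s z + \<zeta> z * (\<zeta> z * s z)) (at z)"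
    using zeta_deriv[OF z] s_has_deriv[OF z] by (auto intro!: derivative_eq_intros)
  then have "(deriv s has_field_derivative - wp z * s z + \<zeta> z * (\<zeta> z * s z)) (at z)"
    by (rule has_field_derivative_transform_within_open[where S = "ball 0 r - {0}"])
      (use z deriv_s in \<open>auto simp: \<zeta>_def\<close>)
  then show ?thesis
    using DERIV_imp_deriv[OF s_has_deriv[OF z]]
    by (simp add: p_def DERIV_imp_deriv power2_eq_square algebra_simps)
qed

text \<open>For fixed v compare logarithmic derivatives in u. On the left it is zeta(u + v) + zeta(u
  - v), for the bracket on the right it is 2 zeta(u) + wp'(u) / (wp(u) - wp(v)); they agree by
  adding \<open>zeta_addition\<close> for (u, v) and (u, -v). The constant is found at u = 0, where
  the left side is s(v) s(-v) and the bracket is 1.\<close>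

lemma sigma_addition_aux:
  assumes v: "v \<in> ball 0 r - {0}" and uv: "norm u + norm v < r"
  shows "s (u + v) * s (u - v) = - (s v)\<^sup>2 * (p u - wp v * (s u)\<^sup>2)"
proof -
  define S where "S = ball (0::complex) (r - norm v)"
  define f where "f t = s (t + v) * s (t - v)" for t
  define g where "g t = p t - wp v * (s t)\<^sup>2" for t
  have r: "norm v < r" using v by simp
  then have S: "open S" "connected S" "0 \<in> S" "u \<in> S" "S \<subseteq> ball 0 r"
    using uv subset_ball[of "r - norm v" r 0] by (auto simp: S_def)
  have S_in: "t + v \<in> ball 0 r" "t - v \<in> ball 0 r" if "t \<in> S" for t
    using that norm_triangle_ineq[of t v] norm_triangle_ineq4[of t v] by (auto simp: S_def)
  have s_shift: "((\<lambda>t. s (t + v)) has_field_derivative deriv s (t + v)) (at t)"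
    "((\<lambda>t. s (t - v)) has_field_derivative deriv s (t - v)) (at t)" if "t \<in> S" for t
    using DERIV_affine[of s _ v 1 t] DERIV_affine[of s _ "- v" 1 t]
      s_has_deriv_at[OF S_in(1)[OF that]] s_has_deriv_at[OF S_in(2)[OF that]]
    by (simp_all add: add.commute)
  then have "(\<lambda>t. s (t + v)) holomorphic_on S" "(\<lambda>t. s (t - v)) holomorphic_on S"
    using S(1) holomorphic_on_open by blast+
  then have holo_f: "f holomorphic_on S"
    unfolding f_def by (intro holomorphic_intros)
  have holo_g: "g holomorphic_on S"
    unfolding g_def by (intro holomorphic_intros holomorphic_on_subset[OF p_holo S(5)]
        holomorphic_on_subset[OF s_holo S(5)])
  have g_0: "g 0 = 1"
    by (simp add: g_def p_def s_0 deriv_s_0)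
  have "f u * g 0 = f 0 * g u"
  proof (rule proportional_if_wronskian_zero[OF holo_f holo_g S(1-3)])
    show "g 0 \<noteq> 0" using g_0 by simp
    fix t assume t: "t \<in> S" "t \<noteq> 0"
    then have t': "t \<in> ball 0 r - {0}" using S(5) by auto
    have g_eq: "g t = (s t)\<^sup>2 * (wp t - wp v)" if "t \<in> S - {0}" for t
      using p_eq[of t] that S(5) by (auto simp: g_def algebra_simps)
    have "((\<lambda>t. (s t)\<^sup>2 * (wp t - wp v)) has_field_derivative
        2 * s t * (\<zeta> t * s t) * (wp t - wp v) + (s t)\<^sup>2 * wp' t) (at t)"
      using s_has_deriv[OF t'] wp_deriv[OF t'] by (auto intro!: derivative_eq_intros)
    then have "(g has_field_derivative
        2 * s t * (\<zeta> t * s t) * (wp t - wp v) + (s t)\<^sup>2 * wp' t) (at t)"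
      by (rule has_field_derivative_transform_within_open[where S = "S - {0}"])
        (use S(1) t g_eq in \<open>auto intro!: open_Diff\<close>)
    then have dg: "deriv g t = 2 * s t * (\<zeta> t * s t) * (wp t - wp v) + (s t)\<^sup>2 * wp' t"
      by (rule DERIV_imp_deriv)
    have df: "deriv f t = deriv s (t + v) * s (t - v) + s (t + v) * deriv s (t - v)"
      unfolding f_def by (rule DERIV_imp_deriv) (use s_shift[OF t(1)] in \<open>auto intro!: derivative_eq_intros\<close>)
    show "deriv f t * g t = f t * deriv g t"
    proof (cases "t + v = 0 \<or> t - v = 0")
      \<comment> \<open>\<open>zeta_addition\<close> does not apply at t = v and t = -v, but there
        \<open>f\<close> and \<open>g\<close> both vanish, so the Wronskian is zero.\<close>
      case True
      then have "t = v \<or> t = - v"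
        by (auto simp: add_eq_0_iff)
      then have "wp t = wp v" "f t = 0"
        using parity(2)[of v] v s_0 by (auto simp: f_def)
      then show ?thesis using t g_eq[of t] by simp
    next
      case False
      then have "2 * (\<zeta> t + \<zeta> v - \<zeta> (t + v)) * (wp t - wp v) + wp' t - wp' v = 0"
        using S_in[OF t(1)] by (intro zeta_addition t' v) auto
      moreover have "2 * (\<zeta> t - \<zeta> v - \<zeta> (t - v)) * (wp t - wp v) + wp' t + wp' v = 0"
        using zeta_addition[OF t', of "- v"] False S_in[OF t(1)] v by (simp add: parity)
      moreover have "deriv s (t + v) = \<zeta> (t + v) * s (t + v)" "deriv s (t - v) = \<zeta> (t - v) * s (t - v)"
        using False S_in[OF t(1)] deriv_s by (auto simp: \<zeta>_def)
      moreover have "g t = (s t)\<^sup>2 * (wp t - wp v)"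
        using g_eq t by simp
      ultimately show ?thesis
        unfolding df dg f_def by algebra
    qed
  qed (use S(4) in auto)
  then show ?thesis
    using s_odd[of v] v by (simp add: g_0 f_def[of 0] power2_eq_square) (simp add: f_def g_def power2_eq_square)
qed

text \<open>Absorbing wp(v) into p(v) removes the pole at v = 0. Both sides are now holomorphic in
  both variables, which makes the formula fit for continuation.\<close>

lemma sigma_addition:
  assumes "norm u + norm v < r"
  shows "s (u + v) * s (u - v) = (s u)\<^sup>2 * p v - (s v)\<^sup>2 * p u"
proof (cases "v = 0")
  case True
  then show ?thesis by (simp add: s_0 p_def deriv_s_0 power2_eq_square)
next
  case False
  then have v: "v \<in> ball 0 r - {0}"
    using assms le_less_trans[of "norm v" "norm u + norm v" r] by simp
  show ?thesis
    unfolding sigma_addition_aux[OF v assms] p_eq[OF v] by (simp add: algebra_simps)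
qed

section \<open>The duplication formulas\<close>

text \<open>Since wp = p / s^2, this numerator of the derivative is s^3 wp', again free of
  division.\<close>

definition q where "q z = deriv p z * s z - 2 * p z * deriv s z"

lemma p_has_deriv:
  assumes z: "z \<in> ball 0 r - {0}"
  shows "(p has_field_derivative 2 * \<zeta> z * (s z)\<^sup>2 * wp z + (s z)\<^sup>2 * wp' z) (at z)"
proof -
  have "((\<lambda>z. (s z)\<^sup>2 * wp z) has_field_derivative
      2 * \<zeta> z * (s z)\<^sup>2 * wp z + (s z)\<^sup>2 * wp' z) (at z)"
    using s_has_deriv[OF z] wp_deriv[OF z]
    by (auto intro!: derivative_eq_intros simp: power2_eq_square algebra_simps)
  then show ?thesis
    by (rule has_field_derivative_transform_within_open[where S = "ball 0 r - {0}"])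
      (use z p_eq in auto)
qed

lemma q_eq: "z \<in> ball 0 r - {0} \<Longrightarrow> q z = s z ^ 3 * wp' z"
  using DERIV_imp_deriv[OF p_has_deriv] DERIV_imp_deriv[OF s_has_deriv] p_eq[of z]
  by (simp add: q_def) (simp add: power2_eq_square power3_eq_cube algebra_simps)

lemma values_at_0: "p 0 = 1" "q 0 = - 2"
  by (simp_all add: p_def q_def s_0 deriv_s_0)

text \<open>Differentiate the addition formula in u at u = v = z. On the left only the derivative of
  s(u - z) survives, as s(0) = 0 and s'(0) = 1, and this gives s(2z).\<close>

lemma s_double:
  assumes z: "z \<in> ball 0 (r / 2) - {0}"
  shows "s (2 * z) = - (s z ^ 4) * wp' z"
proof -
  have zr: "norm z + norm z < r" and zr': "z \<in> ball 0 r - {0}" and zz: "z + z \<in> ball 0 r"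
    and r: "0 \<in> ball (0::complex) r"
  proof -
    have "norm z < r / 2" "norm z \<ge> 0" "norm (z + z) \<le> norm z + norm z" "z \<noteq> 0"
      using z norm_triangle_ineq[of z z] by auto
    then show "norm z + norm z < r" "z \<in> ball 0 r - {0}" "z + z \<in> ball 0 r" "0 \<in> ball (0::complex) r"
      unfolding Diff_iff mem_ball_0 singleton_iff norm_zero by linarith+
  qed
  have "((\<lambda>u. s (u + z)) has_field_derivative deriv s (z + z)) (at z)"
    "((\<lambda>u. s (u - z)) has_field_derivative 1) (at z)"
    using DERIV_affine[of s _ z 1 z] DERIV_affine[of s _ "- z" 1 z]
      s_has_deriv_at[OF zz] s_has_deriv_at[OF r] deriv_s_0
    by (simp_all add: add.commute)
  then have "((\<lambda>u. s (u + z) * s (u - z)) has_field_derivative s (2 * z)) (at z)"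
    by (auto intro!: derivative_eq_intros simp: s_0)
  moreover have "((\<lambda>u. s (u + z) * s (u - z)) has_field_derivative - (s z ^ 4) * wp' z) (at z)"
  proof (rule has_field_derivative_transform_within_open[where S = "ball 0 (r - norm z)"])
    show "((\<lambda>u. - (s z)\<^sup>2 * (p u - wp z * (s u)\<^sup>2)) has_field_derivative - (s z ^ 4) * wp' z) (at z)"
      using p_has_deriv[OF zr'] s_has_deriv[OF zr']
      by (auto intro!: derivative_eq_intros simp: eval_nat_numeral algebra_simps)
    show "- (s z)\<^sup>2 * (p u - wp z * (s u)\<^sup>2) = s (u + z) * s (u - z)" if "u \<in> ball 0 (r - norm z)" for u
      using sigma_addition_aux[OF zr', of u] that by simp
  qed (use zr in auto)
  ultimately show ?thesis
    by (rule DERIV_unique)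
qed

lemma cubic_relation:
  assumes z: "z \<in> ball 0 r"
  shows "(q z)\<^sup>2 = 4 * p z ^ 3 - g2 * p z * s z ^ 4 - g3 * s z ^ 6"
proof (cases "z = 0")
  case True
  then show ?thesis by (simp add: values_at_0 s_0)
next
  case False
  then have z': "z \<in> ball 0 r - {0}" using z by simp
  have "(q z)\<^sup>2 = s z ^ 6 * (4 * wp z ^ 3 - g2 * wp z - g3)"
    unfolding q_eq[OF z'] wp'_squared[OF z', symmetric] by (simp add: power_mult_distrib flip: power_mult)
  then show ?thesis
    unfolding p_eq[OF z'] by (simp add: algebra_simps power_mult_distrib flip: power_mult power_add)
qed

text \<open>Successive logarithmic and ordinary derivatives of \<open>s(2z) = -s(z)\<^sup>4 \<wp>'(z)\<close>.\<close>

lemma duplication_aux: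
  assumes z: "z \<in> ball 0 (r / 2) - {0}"
  shows "wp' z \<noteq> 0"
    and "wp (2 * z) = - 2 * wp z + (6 * (wp z)\<^sup>2 - g2 / 2)\<^sup>2 / (4 * (wp' z)\<^sup>2)"
    and "wp' (2 * z) = - wp' z + 3 * wp z * (6 * (wp z)\<^sup>2 - g2 / 2) / wp' z
      - (6 * (wp z)\<^sup>2 - g2 / 2) ^ 3 / (4 * wp' z ^ 3)"
proof -
  define S where "S = ball (0::complex) (r / 2) - {0}"
  \<comment> \<open>By the second-order equation \<open>w\<close> is the second derivative of
    wp.\<close>
  define w where "w z = 6 * (wp z)\<^sup>2 - g2 / 2" for z
  have S: "open S" "z \<in> S" using z by (auto simp: S_def)
  have S_in: "t \<in> ball 0 r - {0}" "2 * t \<in> ball 0 r - {0}" if "t \<in> S" for t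
    using that norm_ge_zero[of t] by (auto simp: S_def norm_mult simp del: norm_ge_zero)
  have dbl: "s (2 * t) = - (s t ^ 4) * wp' t" if "t \<in> S" for t
    using s_double[of t] that by (simp add: S_def)
  \<comment> \<open>A zero of wp' at t would make s(2t) vanish, while s has no zero in the disc
    except 0.\<close>
  have nz: "wp' t \<noteq> 0" "s t \<noteq> 0" if "t \<in> S" for t
    using dbl[OF that] s_nonzero S_in[OF that] by auto
  have dw: "(w has_field_derivative 12 * wp t * wp' t) (at t)" if "t \<in> S" for t
    unfolding w_def using wp_deriv[OF S_in(1)[OF that]] by (auto intro!: derivative_eq_intros)
  have db: "(wp' has_field_derivative w t) (at t)" if "t \<in> S" for t
    unfolding w_def by (rule wp'_deriv[OF S_in(1)[OF that]])
  have chain: "((\<lambda>t. f (2 * t)) has_field_derivative 2 * d) (at t)"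
    if "(f has_field_derivative d) (at (2 * t))" for f d and t :: complex
    using DERIV_affine[of f d 0 2 t] that by (simp add: mult.commute)
  have zeta: "4 * \<zeta> t + w t / wp' t = 2 * \<zeta> (2 * t)" if t: "t \<in> S" for t
  proof -
    have "((\<lambda>t. s (2 * t)) has_field_derivative 2 * (\<zeta> (2 * t) * s (2 * t))) (at t)"
      by (rule chain[OF s_has_deriv[OF S_in(2)[OF t]]])
    moreover have "((\<lambda>t. s (2 * t)) has_field_derivative
        - (s t ^ 4 * (4 * \<zeta> t * wp' t + w t))) (at t)"
    proof (rule has_field_derivative_transform_within_open[OF _ S(1) t])
      show "((\<lambda>t. - (s t ^ 4) * wp' t) has_field_derivative
          - (s t ^ 4 * (4 * \<zeta> t * wp' t + w t))) (at t)"
        using s_has_deriv[OF S_in(1)[OF t]] db[OF t]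
        by (auto intro!: derivative_eq_intros simp: eval_nat_numeral algebra_simps)
    qed (simp add: dbl)
    ultimately have "2 * (\<zeta> (2 * t) * s (2 * t)) = - (s t ^ 4 * (4 * \<zeta> t * wp' t + w t))"
      by (rule DERIV_unique)
    then have "s t ^ 4 * (2 * \<zeta> (2 * t) * wp' t) = s t ^ 4 * (4 * \<zeta> t * wp' t + w t)"
      unfolding dbl[OF t] by algebra
    then have "2 * \<zeta> (2 * t) * wp' t = 4 * \<zeta> t * wp' t + w t"
      using nz[OF t] by simp
    then show ?thesis
      using nz[OF t] by (simp add: field_simps)
  qed
  have wp: "- 2 * wp t + (w t)\<^sup>2 / (4 * (wp' t)\<^sup>2) = wp (2 * t)" if t: "t \<in> S" for t
  proof -
    have "((\<lambda>t. 2 * \<zeta> (2 * t)) has_field_derivative 2 * (2 * - wp (2 * t))) (at t)"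
      by (intro DERIV_cmult chain zeta_deriv S_in(2)[OF t])
    moreover have "((\<lambda>t. 2 * \<zeta> (2 * t)) has_field_derivative
        4 * - wp t + (12 * wp t * wp' t * wp' t - w t * w t) / (wp' t * wp' t)) (at t)"
    proof (rule has_field_derivative_transform_within_open[OF _ S(1) t])
      show "((\<lambda>t. 4 * \<zeta> t + w t / wp' t) has_field_derivative
        4 * - wp t + (12 * wp t * wp' t * wp' t - w t * w t) / (wp' t * wp' t)) (at t)"
        by (intro DERIV_add DERIV_cmult DERIV_divide zeta_deriv S_in(1)[OF t] dw db nz t)
    qed (simp add: zeta)
    ultimately have "2 * (2 * - wp (2 * t)) =
        4 * - wp t + (12 * wp t * wp' t * wp' t - w t * w t) / (wp' t * wp' t)"
      by (rule DERIV_unique)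
    then have "4 * wp (2 * t) * (wp' t * wp' t) =
        4 * wp t * (wp' t * wp' t) - (12 * wp t * wp' t * wp' t - w t * w t)"
      using nz[OF t] by (simp add: field_simps)
    then show ?thesis
      using nz[OF t] by (simp add: field_simps power2_eq_square)
  qed
  have wp': "- wp' t + 3 * wp t * w t / wp' t - w t ^ 3 / (4 * wp' t ^ 3) = wp' (2 * t)" if t: "t \<in> S" for t
  proof -
    have "((\<lambda>t. wp (2 * t)) has_field_derivative 2 * wp' (2 * t)) (at t)"
      by (intro chain wp_deriv S_in(2)[OF t])
    moreover have "((\<lambda>t. wp (2 * t)) has_field_derivative
        - 2 * wp' t + (2 * w t * (12 * wp t * wp' t) * (4 * (wp' t)\<^sup>2) - (w t)\<^sup>2 * (4 * (2 * wp' t * w t)))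
          / (4 * (wp' t)\<^sup>2 * (4 * (wp' t)\<^sup>2))) (at t)"
    proof (rule has_field_derivative_transform_within_open[OF _ S(1) t])
      have d: "((\<lambda>t. (w t)\<^sup>2) has_field_derivative 2 * w t * (12 * wp t * wp' t)) (at t)"
        "((\<lambda>t. 4 * (wp' t)\<^sup>2) has_field_derivative 4 * (2 * wp' t * w t)) (at t)"
        using dw[OF t] db[OF t] by (auto intro!: derivative_eq_intros)
      show "((\<lambda>t. - 2 * wp t + (w t)\<^sup>2 / (4 * (wp' t)\<^sup>2)) has_field_derivative
          - 2 * wp' t + (2 * w t * (12 * wp t * wp' t) * (4 * (wp' t)\<^sup>2) - (w t)\<^sup>2 * (4 * (2 * wp' t * w t)))
          / (4 * (wp' t)\<^sup>2 * (4 * (wp' t)\<^sup>2))) (at t)"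
        using nz(1)[OF t]
        by (intro DERIV_add[OF DERIV_cmult[OF wp_deriv[OF S_in(1)[OF t]]] DERIV_divide[OF d]]) simp
    qed (rule wp)
    ultimately have "2 * wp' (2 * t) =
        - 2 * wp' t + (2 * w t * (12 * wp t * wp' t) * (4 * (wp' t)\<^sup>2) - (w t)\<^sup>2 * (4 * (2 * wp' t * w t)))
          / (4 * (wp' t)\<^sup>2 * (4 * (wp' t)\<^sup>2))"
      by (rule DERIV_unique)
    moreover have "(2 * w t * (12 * wp t * wp' t) * (4 * (wp' t)\<^sup>2) - (w t)\<^sup>2 * (4 * (2 * wp' t * w t)))
          / (4 * (wp' t)\<^sup>2 * (4 * (wp' t)\<^sup>2)) = 2 * (3 * wp t * w t / wp' t - w t ^ 3 / (4 * wp' t ^ 3))"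
      using nz(1)[OF t] by (simp add: divide_simps) algebra
    ultimately have "2 * wp' (2 * t) = - 2 * wp' t + 2 * (3 * wp t * w t / wp' t - w t ^ 3 / (4 * wp' t ^ 3))"
      by (simp only:)
    moreover have "- b + P - Q = x" if "2 * x = - 2 * b + 2 * (P - Q)" for b P Q x :: complex
      using that by algebra
    ultimately show ?thesis by blast
  qed
  show "wp' z \<noteq> 0" using nz S by blast
  show "wp (2 * z) = - 2 * wp z + (6 * (wp z)\<^sup>2 - g2 / 2)\<^sup>2 / (4 * (wp' z)\<^sup>2)"
    using wp[OF S(2)] by (simp add: w_def)
  show "wp' (2 * z) = - wp' z + 3 * wp z * (6 * (wp z)\<^sup>2 - g2 / 2) / wp' z
      - (6 * (wp z)\<^sup>2 - g2 / 2) ^ 3 / (4 * wp' z ^ 3)"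
    using wp'[OF S(2)] by (simp add: w_def)
qed

text \<open>The formulas for wp(2z) and wp'(2z) have powers of wp'(z) as denominators; multiplied by
  s(2z)^2 and s(2z)^3 they become polynomial in s, p, q, with W = s^4 wp''. Polynomials can be
  evaluated where wp has poles, so the formulas can be iterated without restriction.\<close>

lemma duplication:
  assumes z: "z \<in> ball 0 (r / 2)"
  defines "W \<equiv> 6 * (p z)\<^sup>2 - g2 / 2 * s z ^ 4"
  shows "s (2 * z) = - s z * q z"
    and "p (2 * z) = - 2 * p z * (q z)\<^sup>2 + W\<^sup>2 / 4"
    and "q (2 * z) = q z ^ 4 - 3 * p z * W * (q z)\<^sup>2 + W ^ 3 / 4"
proof -
  have "s (2 * z) = - s z * q z \<and> p (2 * z) = - 2 * p z * (q z)\<^sup>2 + W\<^sup>2 / 4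
    \<and> q (2 * z) = q z ^ 4 - 3 * p z * W * (q z)\<^sup>2 + W ^ 3 / 4"
  proof (cases "z = 0")
    case True
    then show ?thesis by (simp add: values_at_0 s_0 W_def)
  next
    case False
    then have z0: "z \<in> ball 0 (r / 2) - {0}" using z by simp
    have z1: "z \<in> ball 0 r - {0}" "2 * z \<in> ball 0 r - {0}"
      using z0 norm_ge_zero[of z] by (auto simp: norm_mult simp del: norm_ge_zero)
    note nz = duplication_aux(1)[OF z0] s_nonzero[OF z1(1)]
    define w where "w = 6 * (wp z)\<^sup>2 - g2 / 2"
    have W: "W = s z ^ 4 * w"
      unfolding W_def w_def p_eq[OF z1(1)] by (simp add: algebra_simps power_mult_distrib flip: power_mult)
    note eqs = p_eq[OF z1(1)] q_eq[OF z1(1)] p_eq[OF z1(2)] q_eq[OF z1(2)] s_double[OF z0] W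
      duplication_aux(2,3)[OF z0, folded w_def]
    have "s (2 * z) = - s z * q z"
      unfolding eqs by algebra
    moreover have "p (2 * z) = - 2 * p z * (q z)\<^sup>2 + W\<^sup>2 / 4"
      unfolding eqs using nz by (simp add: divide_simps) algebra
    moreover have "q (2 * z) = q z ^ 4 - 3 * p z * W * (q z)\<^sup>2 + W ^ 3 / 4"
      unfolding eqs using nz by (simp add: divide_simps) algebra
    ultimately show ?thesis by blast
  qed
  then show "s (2 * z) = - s z * q z"
    "p (2 * z) = - 2 * p z * (q z)\<^sup>2 + W\<^sup>2 / 4"
    "q (2 * z) = q z ^ 4 - 3 * p z * W * (q z)\<^sup>2 + W ^ 3 / 4"
    by blast+
qed

end

section \<open>The local sigma function\<close>

text \<open>A radius depending continuously on the invariants, within which the scaled invariants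
  stay in the unit disc. Continuity makes the domain of the germs open in all three
  variables.\<close>

definition sigma_radius :: "complex \<Rightarrow> complex \<Rightarrow> real" where
  "sigma_radius g2 g3 = 1 / (1 + norm g2 + norm g3)"

lemma sigma_radius_pos: "sigma_radius g2 g3 > 0"
  unfolding sigma_radius_def using norm_ge_zero[of g2] norm_ge_zero[of g3]
  by (intro divide_pos_pos) linarith+

text \<open>The radius is at most 1, so powers of z beyond the first do not increase |z| |g|, and
  |z| |g| < 1 by the choice of the radius.\<close>

lemma norm_scaled_invariants:
  assumes "norm z \<le> sigma_radius g2 g3"
  shows "norm (z ^ 4 * g2) < 1" "norm (z ^ 6 * g3) < 1"
proof -
  have D: "1 + norm g2 + norm g3 > 0"
    using norm_ge_zero[of g2] norm_ge_zero[of g3] by linarith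
  have le: "norm z * norm g < 1" if "norm g \<le> norm g2 + norm g3" for g :: complex
  proof -
    have "norm z * norm g \<le> sigma_radius g2 g3 * (norm g2 + norm g3)"
      using assms that by (intro mult_mono) (auto simp: sigma_radius_pos less_imp_le)
    also have "\<dots> < 1"
      using D by (simp add: sigma_radius_def field_simps)
    finally show ?thesis .
  qed
  have "sigma_radius g2 g3 \<le> 1"
    using D by (simp add: sigma_radius_def field_simps)
  then have z1: "norm z \<le> 1" using assms by linarith
  have "norm (z ^ Suc n * g) < 1" if "norm g \<le> norm g2 + norm g3" for g n
  proof -
    have "norm (z ^ Suc n * g) = norm z ^ n * (norm z * norm g)"
      by (simp add: norm_mult norm_power)
    also have "\<dots> \<le> 1 * (norm z * norm g)"
      using z1 by (intro mult_right_mono power_le_one) auto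
    finally show ?thesis using le[OF that] by simp
  qed
  from this[of g2 3] this[of g3 5] show "norm (z ^ 4 * g2) < 1" "norm (z ^ 6 * g3) < 1"
    by (simp_all add: numeral_eq_Suc)
qed

section \<open>Formal series and the formal differential equations\<close>

text \<open>The formal variable stands for z^2, so z d/dz corresponds to
  \<open>2 * fps_X * fps_deriv\<close>.\<close>

definition coeff_fps :: "(nat \<Rightarrow> complex) \<Rightarrow> complex \<Rightarrow> complex \<Rightarrow> complex fps" where
  "coeff_fps w g2 g3 = Abs_fps (\<lambda>n. w n * wp_coeff g2 g3 n)"

lemma coeff_fps_nth [simp]: "fps_nth (coeff_fps w g2 g3) n = w n * wp_coeff g2 g3 n"
  by (simp add: coeff_fps_def)

lemma wp_series_eq_eval_fps:
  "wp_series w (z ^ 4 * g2) (z ^ 6 * g3) = eval_fps (coeff_fps w g2 g3) (z\<^sup>2)"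
  unfolding wp_series_def eval_fps_def wp_coeff_homogeneous by (simp add: mult_ac)

text \<open>Test convergence at the real point \<open>?R\<close> on the boundary circle: homogeneity
  moves the powers of \<open>?R\<close> into the invariants, where the geometric bound
  applies.\<close>

lemma coeff_fps_conv_radius:
  fixes z :: complex
  assumes w: "\<And>n. norm (w n) \<le> 2 * real (Suc n)" and z: "norm z < sigma_radius g2 g3"
  shows "ereal (norm (z\<^sup>2)) < fps_conv_radius (coeff_fps w g2 g3)"
proof -
  let ?R = "complex_of_real (sigma_radius g2 g3)"
  have R: "norm ?R = sigma_radius g2 g3"
    using sigma_radius_pos[of g2 g3] by simp
  have "summable (\<lambda>n. fps_nth (coeff_fps w g2 g3) n * (?R\<^sup>2) ^ n)"
  proof (rule summable_comparison_test'[OF summable_linear_times_geometric])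
    fix n
    have "fps_nth (coeff_fps w g2 g3) n * (?R\<^sup>2) ^ n = w n * wp_coeff (?R ^ 4 * g2) (?R ^ 6 * g3) n"
      unfolding wp_coeff_homogeneous by (simp add: mult_ac)
    moreover have "norm (?R ^ 4 * g2) \<le> 1" "norm (?R ^ 6 * g3) \<le> 1"
      using norm_scaled_invariants[of ?R g2 g3] R by (simp_all add: less_imp_le)
    then have "norm (w n * wp_coeff (?R ^ 4 * g2) (?R ^ 6 * g3) n) \<le> 2 * real (Suc n) * (1/2) ^ n"
      unfolding norm_mult[of "w n"] by (intro mult_mono w norm_wp_coeff_le) auto
    ultimately show "norm (fps_nth (coeff_fps w g2 g3) n * (?R\<^sup>2) ^ n) \<le> 2 * real (Suc n) * (1/2) ^ n"
      by (simp only:)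
  qed
  then have "ereal (norm (?R\<^sup>2)) \<le> fps_conv_radius (coeff_fps w g2 g3)"
    unfolding fps_conv_radius_def by (rule conv_radius_geI)
  moreover have "norm (z\<^sup>2) < norm (?R\<^sup>2)"
    using z R by (simp only: norm_power) (intro power_strict_mono; simp)
  ultimately show ?thesis
    by (metis ereal_less_le less_ereal.simps(1) less_le_trans)
qed

text \<open>Evaluated at z^2, the three series are -log(sigma(z)/z) for \<open>wt_e\<close> (two
  integrations of wp - 1/z^2), z^3 wp' + 2 for \<open>wt_b\<close> and z^2 wp - 1 for
  \<open>wt_c\<close>. At n = 0 division by zero gives \<open>wt_e\<close> the value 0.\<close>

abbreviation "wt_e \<equiv> \<lambda>n. 1 / (2 * of_nat n * (2 * of_nat n - 1)) :: complex"
abbreviation "wt_b \<equiv> \<lambda>n. 2 * of_nat n - 2 :: complex"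
abbreviation "wt_c \<equiv> \<lambda>_::nat. 1 :: complex"

lemma weights_le:
  "norm (wt_c n) \<le> 2 * real (Suc n)" "norm (wt_b n) \<le> 2 * real (Suc n)" "norm (wt_e n) \<le> 2 * real (Suc n)"
proof -
  show "norm (wt_c n) \<le> 2 * real (Suc n)" by simp
  show "norm (wt_b n) \<le> 2 * real (Suc n)"
    using norm_triangle_ineq4[of "2 * of_nat n" "2::complex"] by (simp add: norm_mult)
  show "norm (wt_e n) \<le> 2 * real (Suc n)"
  proof (cases "n = 0")
    case False
    then have n: "n \<ge> 1" by simp
    have eq: "2 * of_nat n * (2 * of_nat n - 1) = (of_real (2 * real n * (2 * real n - 1)) :: complex)"
      by simp
    have "2 * real n * (2 * real n - 1) \<ge> 1 * 1"
      using n by (intro mult_mono) auto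
    then have "norm (wt_e n) \<le> 1"
      unfolding eq norm_divide norm_of_real norm_one by (simp add: divide_simps)
    then show ?thesis by simp
  qed simp
qed

lemma coeff_fps_square_nth:
  "fps_nth ((coeff_fps wt_c g2 g3)\<^sup>2) n = (\<Sum>m=2..n-2. wp_coeff g2 g3 m * wp_coeff g2 g3 (n - m))"
proof -
  have "(\<Sum>m=0..n. wp_coeff g2 g3 m * wp_coeff g2 g3 (n - m)) = (\<Sum>m=2..n-2. wp_coeff g2 g3 m * wp_coeff g2 g3 (n - m))"
    by (intro sum.mono_neutral_right) auto
  then show ?thesis by (simp add: power2_eq_square fps_mult_nth)
qed

text \<open>The coefficients of wp'' = 6 wp^2 - g2/2, uniformly in n. It rests on (2n - 2)(2n - 3) -
  12 = 2 (2n + 1)(n - 3), whose zero at n = 3 is the reason why c_3 is free.\<close>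

lemma wp_coeff_recurrence:
  "(2 * of_nat n - 2) * (2 * of_nat n - 3) * wp_coeff g2 g3 n
     = 12 * wp_coeff g2 g3 n + 6 * fps_nth ((coeff_fps wt_c g2 g3)\<^sup>2) n - (if n = 2 then g2 / 2 else 0)"
proof -
  consider "n < 2" | "n = 2" | "n = 3" | "n \<ge> 4" by linarith
  then show ?thesis
  proof cases
    case 4
    have "of_nat n \<noteq> (of_nat 3 :: complex)" "of_nat (2 * n + 1) \<noteq> (0 :: complex)"
      using 4 unfolding of_nat_eq_iff of_nat_eq_0_iff by auto
    then have "of_nat n \<noteq> (3 :: complex)" "2 * of_nat n + 1 \<noteq> (0 :: complex)"
      by (simp_all add: add.commute)
    moreover have cancel: "2 * a * b * (3 / (a * b) * S) = 6 * S" if "a \<noteq> 0" "b \<noteq> 0" for a b S :: complex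
      using that by simp
    ultimately have "2 * (2 * of_nat n + 1) * (of_nat n - 3) * wp_coeff g2 g3 n
      = 6 * fps_nth ((coeff_fps wt_c g2 g3)\<^sup>2) n"
      unfolding wp_coeff_rec[OF 4] coeff_fps_square_nth by (intro cancel) auto
    then show ?thesis using 4 by (simp add: algebra_simps)
  qed (auto simp: coeff_fps_square_nth)
qed

text \<open>In terms of wp these are the product rule for z^2 wp, the second-order equation, the
  first-order equation times z^6, and the relation between E and its second z-derivative. The third
  is a first integral of the second.\<close>

lemma coeff_fps_identities:
  fixes g2 g3
  defines "C \<equiv> coeff_fps wt_c g2 g3" and "B \<equiv> coeff_fps wt_b g2 g3" and "E \<equiv> coeff_fps wt_e g2 g3"
  shows "2 * (fps_X * fps_deriv C) = B + 2 * C"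
    and "2 * (fps_X * fps_deriv B) = 3 * B + 12 * C + 6 * C\<^sup>2 - fps_const (g2 / 2) * fps_X\<^sup>2"
    and "(B - 2)\<^sup>2 - 4 * (1 + C) ^ 3 + fps_const g2 * fps_X\<^sup>2 * (1 + C) + fps_const g3 * fps_X ^ 3 = 0"
    and "4 * (fps_X\<^sup>2 * fps_deriv (fps_deriv E)) + 2 * (fps_X * fps_deriv E) = C"
proof -
  show 1: "2 * (fps_X * fps_deriv C) = B + 2 * C"
    by (rule fps_ext) (auto simp: C_def B_def numeral_fps_const algebra_simps)
  show 2: "2 * (fps_X * fps_deriv B) = 3 * B + 12 * C + 6 * C\<^sup>2 - fps_const (g2 / 2) * fps_X\<^sup>2"
  proof (rule fps_ext)
    fix n
    show "fps_nth (2 * (fps_X * fps_deriv B)) n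
        = fps_nth (3 * B + 12 * C + 6 * C\<^sup>2 - fps_const (g2 / 2) * fps_X\<^sup>2) n"
      using wp_coeff_recurrence[of n g2 g3] 
      by (auto simp: C_def B_def numeral_fps_const fps_X_power_nth algebra_simps)
  qed
  show "4 * (fps_X\<^sup>2 * fps_deriv (fps_deriv E)) + 2 * (fps_X * fps_deriv E) = C"
  proof (rule fps_ext)
    fix n
    show "fps_nth (4 * (fps_X\<^sup>2 * fps_deriv (fps_deriv E)) + 2 * (fps_X * fps_deriv E)) n = fps_nth C n"
    proof (cases "n < 2")
      case True
      then have "n = 0 \<or> n = 1" by auto
      then show ?thesis
        by (auto simp: C_def E_def numeral_fps_const fps_X_power_mult_nth)
    next
      case False
      define m where "m = n - 2"
      have m: "n = m + 2" using False by (simp add: m_def)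
      have nz: "2 * of_nat n - 1 \<noteq> (0 :: complex)" "of_nat n \<noteq> (0 :: complex)"
        using of_nat_eq_iff[of "2 * n" 1, where 'a = complex] False by auto
      have "fps_nth (4 * (fps_X\<^sup>2 * fps_deriv (fps_deriv E)) + 2 * (fps_X * fps_deriv E)) n
          = 2 * of_nat n * (2 * of_nat n - 1) * fps_nth E n"
        unfolding m by (simp add: numeral_fps_const fps_X_power_mult_nth) (simp add: algebra_simps)
      then show ?thesis
        using nz by (simp add: E_def C_def)
    qed
  qed
  define H where "H = (B - 2)\<^sup>2 - 4 * (1 + C) ^ 3 + fps_const g2 * fps_X\<^sup>2 * (1 + C) + fps_const g3 * fps_X ^ 3"
  have G: "fps_const g2 = 2 * fps_const (g2 / 2)"
    by (simp add: numeral_fps_const)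
  have dH: "fps_deriv H = 2 * (B - 2) * fps_deriv B - 12 * (1 + C)\<^sup>2 * fps_deriv C
      + fps_const g2 * (2 * fps_X * (1 + C) + fps_X\<^sup>2 * fps_deriv C) + 3 * fps_const g3 * fps_X\<^sup>2"
    by (simp add: H_def fps_deriv_power power2_eq_square power3_eq_cube algebra_simps)
  \<comment> \<open>\<open>H\<close> represents z^6 (wp'^2 - 4 wp^3 + g2 wp + g3). Constancy of the
    bracket along solutions reads z dH/dz = 6 H.\<close>
  have XH: "2 * (fps_X * fps_deriv H) = 6 * H"
    using 1 2 unfolding dH unfolding H_def G by algebra
  have mult_nth: "fps_nth (F * G) 1 = fps_nth F 0 * fps_nth G 1 + fps_nth F 1 * fps_nth G 0"
    "fps_nth (F * G) 2 = fps_nth F 0 * fps_nth G 2 + fps_nth F 1 * fps_nth G 1 + fps_nth F 2 * fps_nth G 0"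
    "fps_nth (F * G) 3 = fps_nth F 0 * fps_nth G 3 + fps_nth F 1 * fps_nth G 2
       + fps_nth F 2 * fps_nth G 1 + fps_nth F 3 * fps_nth G 0" for F G :: "complex fps"
    by (simp_all add: fps_mult_nth eval_nat_numeral)
  have "fps_nth H n = 0" for n
  proof (cases "n = 3")
    case True
    \<comment> \<open>The equation for \<open>H\<close> leaves only this coefficient open. It equals
      g3 - 28 c_3, so the start value g3/28 is exactly what makes it vanish.\<close>
    have "fps_nth H 3 = 0"
      unfolding H_def power2_eq_square power3_eq_cube 
      by (simp add: mult_nth C_def B_def numeral_fps_const fps_X_def)
    then show ?thesis using True by simp
  next
    case False
    have "of_nat n * fps_nth H n = 3 * fps_nth H n"
      using arg_cong[OF XH, of "\<lambda>F. fps_nth F n"] by (cases n) (simp_all add: numeral_fps_const)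
    moreover have "of_nat n \<noteq> (of_nat 3 :: complex)"
      using False unfolding of_nat_eq_iff .
    ultimately show ?thesis by simp
  qed
  then have "H = 0"
    by (intro fps_ext) simp
  then show "(B - 2)\<^sup>2 - 4 * (1 + C) ^ 3 + fps_const g2 * fps_X\<^sup>2 * (1 + C) + fps_const g3 * fps_X ^ 3 = 0"
    by (simp add: H_def)
qed


text \<open>The germs of \<open>\<sigma>\<close>, \<open>\<sigma>\<^sup>2 \<wp>\<close> and \<open>\<sigma>\<^sup>3 \<wp>'\<close>.\<close>

definition local_sigma :: "complex \<Rightarrow> complex \<Rightarrow> complex \<Rightarrow> complex" where
  "local_sigma z g2 g3 = z * exp (- wp_series wt_e (z ^ 4 * g2) (z ^ 6 * g3))"
definition local_p :: "complex \<Rightarrow> complex \<Rightarrow> complex \<Rightarrow> complex" where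
  "local_p z g2 g3 =
     exp (- 2 * wp_series wt_e (z ^ 4 * g2) (z ^ 6 * g3)) * (1 + wp_series wt_c (z ^ 4 * g2) (z ^ 6 * g3))"
definition local_q :: "complex \<Rightarrow> complex \<Rightarrow> complex \<Rightarrow> complex" where
  "local_q z g2 g3 =
     exp (- 3 * wp_series wt_e (z ^ 4 * g2) (z ^ 6 * g3)) * (wp_series wt_b (z ^ 4 * g2) (z ^ 6 * g3) - 2)"

abbreviation local_e :: "complex \<Rightarrow> complex \<Rightarrow> complex \<Rightarrow> complex" where
  "local_e g2 g3 \<equiv> \<lambda>z. 2 * z * eval_fps (fps_deriv (coeff_fps wt_e g2 g3)) (z\<^sup>2)"

section \<open>From formal series to the germ\<close>

lemma eval_fps_eq_hom:
  fixes F G :: "complex fps"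
  assumes "ereal (norm y) < fps_conv_radius F" "ereal (norm y) < fps_conv_radius G"
  shows "ereal (norm y) < fps_conv_radius (F + G)" "eval_fps (F + G) y = eval_fps F y + eval_fps G y"
    and "ereal (norm y) < fps_conv_radius (F - G)" "eval_fps (F - G) y = eval_fps F y - eval_fps G y"
    and "ereal (norm y) < fps_conv_radius (F * G)" "eval_fps (F * G) y = eval_fps F y * eval_fps G y"
proof -
  have m: "ereal (norm y) < min (fps_conv_radius F) (fps_conv_radius G)"
    using assms by simp
  show "ereal (norm y) < fps_conv_radius (F + G)" "ereal (norm y) < fps_conv_radius (F - G)"
    "ereal (norm y) < fps_conv_radius (F * G)"
    by (rule less_le_trans[OF m], rule fps_conv_radius_add fps_conv_radius_diff fps_conv_radius_mult)+
qed (use assms in \<open>simp_all add: eval_fps_add eval_fps_diff eval_fps_mult\<close>)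

text \<open>Evaluating the formal identities at z^2 gives e' = fC / z^2, e'' = fB / z^3 and both
  differential equations; e is the derivative of fE = -log(s/z), hence s'/s = 1/z - e.\<close>

lemma local_sigma_germ:
  fixes g2 g3
  defines "r \<equiv> sigma_radius g2 g3" and "s \<equiv> \<lambda>z. local_sigma z g2 g3"
    and "e \<equiv> local_e g2 g3"
  shows "sigma_germ r g2 g3 s e"
    and "z \<in> ball 0 r \<Longrightarrow> sigma_germ.p s z = local_p z g2 g3"
    and "z \<in> ball 0 r \<Longrightarrow> sigma_germ.q s z = local_q z g2 g3"
proof -
  define C where "C = coeff_fps wt_c g2 g3"
  define B where "B = coeff_fps wt_b g2 g3"
  define E where "E = coeff_fps wt_e g2 g3"
  define fC where "fC z = eval_fps C (z\<^sup>2)" for z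
  define fB where "fB z = eval_fps B (z\<^sup>2)" for z
  define fE where "fE z = eval_fps E (z\<^sup>2)" for z
  have rad: "ereal (norm (z\<^sup>2)) < fps_conv_radius C" "ereal (norm (z\<^sup>2)) < fps_conv_radius B"
    "ereal (norm (z\<^sup>2)) < fps_conv_radius E" if "z \<in> ball 0 r" for z :: complex
  proof -
    have "norm z < sigma_radius g2 g3" using that by (simp add: r_def)
    then show "ereal (norm (z\<^sup>2)) < fps_conv_radius C" "ereal (norm (z\<^sup>2)) < fps_conv_radius B"
      "ereal (norm (z\<^sup>2)) < fps_conv_radius E"
      unfolding C_def B_def E_def by (rule coeff_fps_conv_radius[OF weights_le(1)]
        coeff_fps_conv_radius[OF weights_le(2)] coeff_fps_conv_radius[OF weights_le(3)])+
  qed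
  have rad': "ereal (norm (z\<^sup>2)) < fps_conv_radius (fps_deriv F)"
    if "ereal (norm (z\<^sup>2)) < fps_conv_radius F" for F :: "complex fps" and z :: complex
    using that fps_conv_radius_deriv[of F] by (rule less_le_trans)
  have deriv_eval: "((\<lambda>z. eval_fps F (z\<^sup>2)) has_field_derivative 2 * z * eval_fps (fps_deriv F) (z\<^sup>2)) (at z)"
    if "ereal (norm (z\<^sup>2)) < fps_conv_radius F" for F :: "complex fps" and z
  proof -
    have "(eval_fps F has_field_derivative eval_fps (fps_deriv F) (z\<^sup>2)) (at (z\<^sup>2))"
      using that by (intro has_field_derivative_eval_fps)
    moreover have "((\<lambda>z. z\<^sup>2) has_field_derivative 2 * z) (at z)"
      by (auto intro!: derivative_eq_intros)
    ultimately show ?thesis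
      using DERIV_chain2[where f = "eval_fps F" and g = "\<lambda>z. z\<^sup>2" and x = z] by (metis mult.commute)
  qed
  note ids = coeff_fps_identities[of g2 g3, folded C_def B_def E_def]
  have id1: "2 * z\<^sup>2 * eval_fps (fps_deriv C) (z\<^sup>2) = fB z + 2 * fC z" if "z \<in> ball 0 r" for z
    using arg_cong[OF ids(1), of "\<lambda>F. eval_fps F (z\<^sup>2)"] rad[OF that]
    by (simp add: eval_fps_eq_hom rad' fB_def fC_def mult.assoc)
  have id2: "2 * z\<^sup>2 * eval_fps (fps_deriv B) (z\<^sup>2) = 3 * fB z + 12 * fC z + 6 * (fC z)\<^sup>2 - g2 / 2 * z ^ 4"
    if "z \<in> ball 0 r" for z
    using arg_cong[OF ids(2), of "\<lambda>F. eval_fps F (z\<^sup>2)"] rad[OF that]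
    by (simp add: eval_fps_eq_hom rad' fB_def fC_def mult.assoc power2_eq_square[of fps_X]
        power2_eq_square[of C]) (simp add: power2_eq_square eval_nat_numeral mult_ac)
  have id3: "(fB z - 2)\<^sup>2 = 4 * (1 + fC z) ^ 3 - g2 * z ^ 4 * (1 + fC z) - g3 * z ^ 6"
    if "z \<in> ball 0 r" for z
    using arg_cong[OF ids(3), of "\<lambda>F. eval_fps F (z\<^sup>2)"] rad[OF that]
    by (simp add: eval_fps_eq_hom rad' fB_def fC_def mult.assoc power2_eq_square power3_eq_cube)
      (simp add: eval_nat_numeral algebra_simps)
  have id4: "4 * z ^ 4 * eval_fps (fps_deriv (fps_deriv E)) (z\<^sup>2)
      + 2 * z\<^sup>2 * eval_fps (fps_deriv E) (z\<^sup>2) = fC z"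
    if "z \<in> ball 0 r" for z
    using arg_cong[OF ids(4), of "\<lambda>F. eval_fps F (z\<^sup>2)"] rad[OF that]
    by (simp add: eval_fps_eq_hom rad' fB_def fC_def mult.assoc power2_eq_square[of fps_X])
  have e_eq: "e z = 2 * z * eval_fps (fps_deriv E) (z\<^sup>2)" for z
    by (simp add: e_def E_def)
  have s_eq: "s z = z * exp (- fE z)" for z
    by (simp add: s_def local_sigma_def wp_series_eq_eval_fps fE_def E_def)
  have at_0: "fE 0 = 0" "fC 0 = 0" "fB 0 = 0"
    by (simp_all add: fE_def fC_def fB_def E_def C_def B_def eval_fps_at_0)
  have fC_deriv: "(fC has_field_derivative 2 * z * eval_fps (fps_deriv C) (z\<^sup>2)) (at z)"
    and fB_deriv: "(fB has_field_derivative 2 * z * eval_fps (fps_deriv B) (z\<^sup>2)) (at z)" if "z \<in> ball 0 r" for z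
    unfolding fC_def fB_def by (rule deriv_eval[OF rad(1)[OF that]] deriv_eval[OF rad(2)[OF that]])+
  have fE_deriv: "(fE has_field_derivative e z) (at z)" if "z \<in> ball 0 r" for z
    unfolding fE_def e_eq by (rule deriv_eval[OF rad(3)[OF that]])
  have e_deriv: "(e has_field_derivative
      2 * eval_fps (fps_deriv E) (z\<^sup>2) + 4 * z\<^sup>2 * eval_fps (fps_deriv (fps_deriv E)) (z\<^sup>2)) (at z)"
    if "z \<in> ball 0 r" for z
    unfolding e_eq
    by (rule DERIV_cong[OF DERIV_mult[OF DERIV_cmult[OF DERIV_ident] deriv_eval[OF rad'[OF rad(3)[OF that]]]]])
      (simp add: power2_eq_square)
  have de: "deriv e z = fC z / z\<^sup>2" if "z \<in> ball 0 r - {0}" for z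
    using DERIV_imp_deriv[OF e_deriv, of z] id4[of z] that
    by (simp add: field_simps eval_nat_numeral)
  have dde: "deriv (deriv e) z = fB z / z ^ 3" if z: "z \<in> ball 0 r - {0}" for z
  proof (rule DERIV_imp_deriv, rule has_field_derivative_transform_within_open[where S = "ball 0 r - {0}"])
    show "((\<lambda>z. fC z / z\<^sup>2) has_field_derivative fB z / z ^ 3) (at z)"
      using fC_deriv[of z] z id1[of z]
      by (auto intro!: derivative_eq_intros simp: field_simps eval_nat_numeral)
  qed (use z de in auto)
  have ddde: "deriv (deriv (deriv e)) z = (12 * fC z + 6 * (fC z)\<^sup>2) / z ^ 4 - g2 / 2"
    if z: "z \<in> ball 0 r - {0}" for z
  proof (rule DERIV_imp_deriv, rule has_field_derivative_transform_within_open[where S = "ball 0 r - {0}"])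
    show "((\<lambda>z. fB z / z ^ 3) has_field_derivative (12 * fC z + 6 * (fC z)\<^sup>2) / z ^ 4 - g2 / 2) (at z)"
    proof (rule DERIV_cong)
      show "((\<lambda>z. fB z / z ^ 3) has_field_derivative
          (2 * z * eval_fps (fps_deriv B) (z\<^sup>2) * z ^ 3 - fB z * (3 * z\<^sup>2)) / (z ^ 3 * z ^ 3)) (at z)"
        using z by (intro DERIV_divide fB_deriv) (auto intro!: derivative_eq_intros)
      have num: "2 * z * eval_fps (fps_deriv B) (z\<^sup>2) * z ^ 3 - fB z * (3 * z\<^sup>2) =
          z\<^sup>2 * (12 * fC z + 6 * (fC z)\<^sup>2 - g2 / 2 * z ^ 4)"
        using id2[of z] z by algebra
      show "(2 * z * eval_fps (fps_deriv B) (z\<^sup>2) * z ^ 3 - fB z * (3 * z\<^sup>2)) / (z ^ 3 * z ^ 3)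
          = (12 * fC z + 6 * (fC z)\<^sup>2) / z ^ 4 - g2 / 2"
        unfolding num using z by (simp add: field_simps eval_nat_numeral)
    qed
  qed (use z dde in auto)
  have s_deriv: "(s has_field_derivative exp (- fE z) - z * e z * exp (- fE z)) (at z)" if "z \<in> ball 0 r" for z
    unfolding s_eq using fE_deriv[OF that] by (auto intro!: derivative_eq_intros simp: algebra_simps)
  have holo: "s holomorphic_on ball 0 r" "e holomorphic_on ball 0 r"
    using holomorphic_on_open[OF open_ball] s_deriv e_deriv by blast+
  have r: "r > 0" unfolding r_def by (rule sigma_radius_pos)
  show germ: "sigma_germ r g2 g3 s e"
  proof
    fix z :: complex assume z: "z \<in> ball 0 r - {0}"
    then show "deriv s z = (1 / z - e z) * s z"
      unfolding DERIV_imp_deriv[OF s_deriv[OF DiffD1[OF z]]] by (simp add: s_eq field_simps)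
    show "(deriv (deriv e) z - 2 / z ^ 3)\<^sup>2
        = 4 * (deriv e z + 1 / z\<^sup>2) ^ 3 - g2 * (deriv e z + 1 / z\<^sup>2) - g3"
    proof -
      have "(deriv (deriv e) z - 2 / z ^ 3)\<^sup>2 = (fB z - 2)\<^sup>2 / z ^ 6"
        using z dde[OF z] by (simp add: power_divide flip: diff_divide_distrib power_mult)
      also have "\<dots> = 4 * ((1 + fC z) / z\<^sup>2) ^ 3 - g2 * ((1 + fC z) / z\<^sup>2) - g3"
        unfolding id3[OF DiffD1[OF z]] using z by (simp add: field_simps eval_nat_numeral)
      finally show ?thesis
        using de[OF z] by (simp add: add_divide_distrib add.commute)
    qed
    show "deriv (deriv (deriv e)) z + 6 / z ^ 4 = 6 * (deriv e z + 1 / z\<^sup>2)\<^sup>2 - g2 / 2"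
      using z unfolding ddde[OF z] de[OF z] by (simp add: field_simps eval_nat_numeral)
  qed (use holo r DERIV_imp_deriv[OF s_deriv, of 0] in \<open>auto simp: e_eq s_eq fE_def E_def eval_fps_at_0\<close>)
  interpret sigma_germ r g2 g3 s e by (rule germ)
  have lp: "local_p z g2 g3 = exp (- 2 * fE z) * (1 + fC z)"
    and lq: "local_q z g2 g3 = exp (- 3 * fE z) * (fB z - 2)" for z
    by (simp_all add: local_p_def local_q_def wp_series_eq_eval_fps fE_def fC_def fB_def E_def C_def B_def)
  have exps: "exp (- 2 * fE z) = exp (- fE z) ^ 2" "exp (- 3 * fE z) = exp (- fE z) ^ 3" for z
    by (simp_all flip: exp_of_nat_mult)
  show "p z = local_p z g2 g3" if "z \<in> ball 0 r"
  proof (cases "z = 0")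
    case True
    then show ?thesis by (simp add: values_at_0 lp at_0)
  next
    case False
    then have z: "z \<in> ball 0 r - {0}" using that by simp
    show ?thesis
      unfolding p_eq[OF z] wp_def de[OF z] lp exps s_eq using False
      by (simp add: field_simps power2_eq_square)
  qed
  show "q z = local_q z g2 g3" if "z \<in> ball 0 r"
  proof (cases "z = 0")
    case True
    then show ?thesis by (simp add: values_at_0 lq at_0)
  next
    case False
    then have z: "z \<in> ball 0 r - {0}" using that by simp
    show ?thesis
      unfolding q_eq[OF z] wp'_def dde[OF z] lq exps s_eq using False
      by (simp add: field_simps power3_eq_cube)
  qed
qed

section \<open>Uniqueness of the sigma function\<close>

text \<open>
  If \<open>q1 - q2\<close> vanished to finite order \<open>m\<close> at \<open>0\<close>, comparing leading terms in the difference of the two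
  equations would force \<open>-4 m = 12\<close>.
\<close>

lemma wp_regular_part_unique:
  fixes q1 q2 :: "complex \<Rightarrow> complex"
  assumes holo: "q1 holomorphic_on ball 0 r" "q2 holomorphic_on ball 0 r"
    and ode: "\<And>q z. q \<in> {q1, q2} \<Longrightarrow> z \<in> ball 0 r - {0} \<Longrightarrow>
      (deriv q z - 2 / z ^ 3)\<^sup>2 = 4 * (q z + 1 / z\<^sup>2) ^ 3 - g2 * (q z + 1 / z\<^sup>2) - g3"
    and z: "z \<in> ball 0 r"
  shows "q1 z = q2 z"
proof (rule ccontr)
  assume "q1 z \<noteq> q2 z"
  define d where "d z = q1 z - q2 z" for z
  define m where "m = nat (zorder d 0)"
  define G where "G = zor_poly d 0"
  have "r > 0" using zero_le_dist[of 0 z] z unfolding mem_ball by (rule le_less_trans)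
  then have 0: "0 \<in> ball (0::complex) r" by simp
  have nz: "\<exists>w\<in>ball 0 r. d w \<noteq> 0"
    using \<open>q1 z \<noteq> q2 z\<close> z unfolding d_def by force
  have d: "d holomorphic_on ball 0 r"
    unfolding d_def by (intro holomorphic_intros holo)
  have "\<exists>\<rho>>0. cball (0::complex) \<rho> \<subseteq> ball 0 r \<and> G holomorphic_on cball 0 \<rho>
      \<and> (\<forall>w\<in>cball 0 \<rho>. d w = G w * (w - 0) ^ m \<and> G w \<noteq> 0)"
    using zorder_exist_zero[OF d open_ball connected_ball 0 nz, THEN conjunct2] unfolding m_def G_def .
  then obtain \<rho> where \<rho>: "\<rho> > 0" "cball (0::complex) \<rho> \<subseteq> ball 0 r" and G_holo: "G holomorphic_on cball 0 \<rho>"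
    and G: "\<forall>w\<in>cball 0 \<rho>. d w = G w * (w - 0) ^ m \<and> G w \<noteq> 0"
    by blast
  have sub: "ball (0::complex) \<rho> \<subseteq> ball 0 r" "ball (0::complex) \<rho> \<subseteq> cball 0 \<rho>" using \<rho>(2) by auto
  have holo': "q1 holomorphic_on ball 0 \<rho>" "q2 holomorphic_on ball 0 \<rho>" "G holomorphic_on ball 0 \<rho>"
    using holo G_holo sub by (auto intro: holomorphic_on_subset)
  have reg: "- 4 * w * deriv q w + w ^ 4 * (deriv q w)\<^sup>2 = 12 * q w + 12 * w\<^sup>2 * (q w)\<^sup>2
      + 4 * w ^ 4 * q w ^ 3 - g2 * w\<^sup>2 - g2 * w ^ 4 * q w - g3 * w ^ 4"
    if "q \<in> {q1, q2}" "w \<in> ball 0 \<rho> - {0}" for q w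
  proof -
    have "w \<noteq> 0" "w \<in> ball 0 r - {0}" using that sub by auto
    \<comment> \<open>The inverse is kept as an unknown with w i = 1, so that the step is
      polynomial. The terms 4 i^6 cancel and multiplication by w^4 clears the remaining
      poles.\<close>
    define i where "i = 1 / w"
    have i: "w * i = 1" "2 / w ^ 3 = 2 * i ^ 3" "1 / w\<^sup>2 = i\<^sup>2"
      using \<open>w \<noteq> 0\<close> by (simp_all add: i_def power_one_over field_simps)
    have "(deriv q w - 2 * i ^ 3)\<^sup>2 = 4 * (q w + i\<^sup>2) ^ 3 - g2 * (q w + i\<^sup>2) - g3"
      using ode[OF that(1) \<open>w \<in> ball 0 r - {0}\<close>] unfolding i .
    then show ?thesis
      using i(1) by algebra
  qed
  \<comment> \<open>Both sides of the difference of the two equations, divided by w^m. At 0 they are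
    -4 m G(0) and 12 G(0).\<close>
  define L where "L w = (w * deriv G w + of_nat m * G w) * (w ^ 3 * (deriv q1 w + deriv q2 w) - 4)" for w
  define R where "R w = G w * (12 + 12 * w\<^sup>2 * (q1 w + q2 w)
      + 4 * w ^ 4 * ((q1 w)\<^sup>2 + q1 w * q2 w + (q2 w)\<^sup>2) - g2 * w ^ 4)" for w
  have "L 0 = R 0"
  proof (rule holomorphic_eq_if_eq_on_punctured_ball[of L 0 \<rho> R 0])
    show "L holomorphic_on ball 0 \<rho>" "R holomorphic_on ball 0 \<rho>"
      unfolding L_def R_def by (intro holomorphic_intros holomorphic_deriv holo' open_ball)+
    show "0 \<in> ball (0::complex) \<rho>" using \<rho>(1) by simp
    fix w :: complex assume w: "w \<in> ball 0 \<rho>" "w \<noteq> 0"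
    then have w': "w \<in> ball 0 \<rho> - {0}" by simp
    have "((\<lambda>w. G w * w ^ m) has_field_derivative deriv G w * w ^ m + G w * (of_nat m * w ^ (m - 1))) (at w)"
      using holomorphic_derivI[OF holo'(3) open_ball w(1)] by (auto intro!: derivative_eq_intros)
    then have "(d has_field_derivative deriv G w * w ^ m + G w * (of_nat m * w ^ (m - 1))) (at w)"
      by (rule has_field_derivative_transform_within_open[where S = "ball 0 \<rho>"]) (use w G in auto)
    moreover have "(d has_field_derivative deriv q1 w - deriv q2 w) (at w)"
      unfolding d_def using w(1) by (intro DERIV_diff holomorphic_derivI[OF holo'(1)] holomorphic_derivI[OF holo'(2)]) auto
    ultimately have diff: "deriv q1 w - deriv q2 w = deriv G w * w ^ m + G w * (of_nat m * w ^ (m - 1))"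
      by (rule DERIV_unique[symmetric])
    \<comment> \<open>For m = 0 the exponent \<open>m - 1\<close> is truncated to 0, but the factor
      \<open>of_nat m\<close> makes both sides zero.\<close>
    have pow: "of_nat m * w ^ (m - 1) * w = of_nat m * w ^ m"
      by (cases m) auto
    have "w * x = W * (w * y + k * v)" if "x = y * W + v * (k * W')" "k * W' * w = k * W"
      for x y k v W W' :: complex
      using that by algebra
    from this[OF diff pow] have dd: "w * (deriv q1 w - deriv q2 w) = w ^ m * (w * deriv G w + of_nat m * G w)" .
    have dq: "q1 w - q2 w = w ^ m * G w"
      using G w by (simp add: d_def mult.commute)
    have "w ^ m * L w = w * (deriv q1 w - deriv q2 w) * (w ^ 3 * (deriv q1 w + deriv q2 w) - 4)"
      unfolding dd L_def by (simp only: mult.assoc)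
    also have "\<dots> = (- 4 * w * deriv q1 w + w ^ 4 * (deriv q1 w)\<^sup>2) - (- 4 * w * deriv q2 w + w ^ 4 * (deriv q2 w)\<^sup>2)"
      by algebra
    also have "\<dots> = (q1 w - q2 w) * (12 + 12 * w\<^sup>2 * (q1 w + q2 w)
      + 4 * w ^ 4 * ((q1 w)\<^sup>2 + q1 w * q2 w + (q2 w)\<^sup>2) - g2 * w ^ 4)"
      unfolding reg[OF insertI1 w'] reg[OF insertI2[OF singletonI] w'] by algebra
    also have "\<dots> = w ^ m * R w"
      unfolding dq R_def by (simp only: mult.assoc)
    finally have "w ^ m * L w = w ^ m * R w" .
    then show "L w = R w" using w by simp
  qed
  then have "(- 4 * of_nat m - 12) * G 0 = 0"
    by (simp add: L_def R_def algebra_simps)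
  moreover have "G 0 \<noteq> 0" using G \<rho>(1) by simp
  ultimately have "- 4 * of_nat m - 12 = (0 :: complex)" by (simp only: mult_eq_0_iff) simp
  moreover have "of_nat (4 * m + 12) = - (- 4 * of_nat m - 12 :: complex)" by simp
  ultimately have "of_nat (4 * m + 12) = (0 :: complex)" by (simp only: neg_0_equal_iff_equal minus_zero)
  then show False
    unfolding of_nat_eq_0_iff by simp
qed

lemma entire_eqI:
  fixes f g :: "complex \<Rightarrow> complex"
  assumes "f holomorphic_on UNIV" "g holomorphic_on UNIV" "r > 0" "\<And>z. z \<in> ball 0 r \<Longrightarrow> f z = g z"
  shows "f = g"
proof
  fix z
  show "f z = g z"
    by (rule analytic_continuation_open[of "ball 0 r" UNIV f g]) (use assms in auto)
qed

text \<open>An odd f with f'(0) = 1 is z h(z) with h even, h(0) = 1 and h'(0) = 0. Its logarithmic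
  derivative is 1/z + h'/h, so near 0 the differential equation becomes one for the holomorphic
  function -h'/h.\<close>

lemma weierstrass_sigma_germ:
  assumes "is_weierstrass_sigma g2 g3 f"
  obtains r h where "r > 0" "h holomorphic_on UNIV" "\<And>z. f z = z * h z" "h 0 = 1" "deriv h 0 = 0"
    "\<And>z. z \<in> ball 0 r \<Longrightarrow> h z \<noteq> 0"
    "\<And>z. z \<in> ball 0 r - {0} \<Longrightarrow>
      (deriv (deriv (\<lambda>z. - deriv h z / h z)) z - 2 / z ^ 3)\<^sup>2
        = 4 * (deriv (\<lambda>z. - deriv h z / h z) z + 1 / z\<^sup>2) ^ 3
          - g2 * (deriv (\<lambda>z. - deriv h z / h z) z + 1 / z\<^sup>2) - g3"
proof -
  from assms have holo: "f holomorphic_on UNIV" and odd: "\<And>z. f (- z) = - f z" and d0: "deriv f 0 = 1"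
    and ode: "\<And>z. f z \<noteq> 0 \<Longrightarrow>
      (deriv (wp_of_sigma f) z)\<^sup>2 = 4 * wp_of_sigma f z ^ 3 - g2 * wp_of_sigma f z - g3"
    by (auto simp: is_weierstrass_sigma_def)
  have f0: "f 0 = 0" using odd[of 0] by simp
  define h where "h z = (if z = 0 then 1 else f z / z)" for z
  have h: "h holomorphic_on UNIV"
    by (rule pole_theorem_0[OF holo, where a = 0]) (auto simp: h_def f0 d0)
  have h_0: "h 0 = 1" by (simp add: h_def)
  have f_eq: "f z = z * h z" for z by (simp add: h_def f0)
  have h_even: "h (- z) = h z" for z by (simp add: h_def odd)
  have h_deriv: "(h has_field_derivative deriv h z) (at z)" for z
    using holomorphic_derivI[OF h] by simp
  have "((\<lambda>z. h (- z)) has_field_derivative - deriv h 0) (at 0)"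
    using DERIV_affine[of h "deriv h 0" 0 "-1" 0] h_deriv by simp
  then have "- deriv h 0 = deriv h 0"
    unfolding h_even using h_deriv[of 0] by (rule DERIV_unique)
  then have dh0: "deriv h 0 = 0" by (simp add: complex_eq_iff)
  have "open (h -` (- {0}))"
    by (intro open_vimage holomorphic_on_imp_continuous_on h open_Compl closed_singleton)
  moreover have "0 \<in> h -` (- {0})" by (simp add: h_0)
  ultimately obtain r where r: "r > 0" "ball 0 r \<subseteq> h -` (- {0})"
    by (rule openE)
  define e where "e z = - deriv h z / h z" for z
  have nz: "h z \<noteq> 0" if "z \<in> ball 0 r" for z using that r by auto
  have e_holo: "e holomorphic_on ball 0 r"
    unfolding e_def using nz by (intro holomorphic_intros holomorphic_on_subset[OF h]
        holomorphic_on_subset[OF holomorphic_deriv[OF h open_UNIV]]) auto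
  have e'_holo: "deriv e holomorphic_on ball 0 r"
    by (intro holomorphic_deriv e_holo open_ball)
  define S where "S = ball 0 r - {0 :: complex}"
  have S: "open S" by (auto simp: S_def)
  have ld: "log_deriv f z = 1 / z - e z" if "z \<in> S" for z
  proof -
    have "(f has_field_derivative h z + z * deriv h z) (at z)"
      unfolding f_eq using h_deriv by (auto intro!: derivative_eq_intros)
    then have "deriv f z = h z + z * deriv h z" by (rule DERIV_imp_deriv)
    then show ?thesis
      using that nz[of z] by (simp add: log_deriv_def f_eq e_def S_def field_simps)
  qed
  have wp: "wp_of_sigma f z = deriv e z + 1 / z\<^sup>2" if z: "z \<in> S" for z
  proof -
    have "((\<lambda>z. 1 / z - e z) has_field_derivative - (1 / z\<^sup>2) - deriv e z) (at z)"
      using z holomorphic_derivI[OF e_holo open_ball, of z]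
      by (auto intro!: derivative_eq_intros simp: S_def power2_eq_square)
    then have "(log_deriv f has_field_derivative - (1 / z\<^sup>2) - deriv e z) (at z)"
      by (rule has_field_derivative_transform_within_open[OF _ S z]) (simp add: ld)
    then show ?thesis
      by (simp add: wp_of_sigma_def DERIV_imp_deriv)
  qed
  have wp': "deriv (wp_of_sigma f) z = deriv (deriv e) z - 2 / z ^ 3" if z: "z \<in> S" for z
  proof -
    have "((\<lambda>z. deriv e z + 1 / z\<^sup>2) has_field_derivative deriv (deriv e) z - 2 / z ^ 3) (at z)"
      using z holomorphic_derivI[OF e'_holo open_ball, of z]
      by (auto intro!: derivative_eq_intros simp: S_def eval_nat_numeral field_simps)
    then have "(wp_of_sigma f has_field_derivative deriv (deriv e) z - 2 / z ^ 3) (at z)"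
      by (rule has_field_derivative_transform_within_open[OF _ S z]) (simp add: wp)
    then show ?thesis
      by (rule DERIV_imp_deriv)
  qed
  show ?thesis
  proof (rule that[OF r(1) h f_eq h_0 dh0 nz])
    fix z :: complex assume z: "z \<in> ball 0 r - {0}"
    then have "z \<in> S" "f z \<noteq> 0" using nz[of z] by (auto simp: S_def f_eq)
    then show "(deriv (deriv (\<lambda>z. - deriv h z / h z)) z - 2 / z ^ 3)\<^sup>2
        = 4 * (deriv (\<lambda>z. - deriv h z / h z) z + 1 / z\<^sup>2) ^ 3
          - g2 * (deriv (\<lambda>z. - deriv h z / h z) z + 1 / z\<^sup>2) - g3"
      using ode[of z] wp[of z] wp'[of z] by (simp add: e_def[abs_def])
  qed
qed

text \<open>The regular parts of the two wp-functions agree, so e1 - e2 is constant, and it is 0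
  because both vanish at 0. Then h1 and h2 have equal logarithmic derivatives and equal value 1 at
  0, hence agree near 0 and everywhere.\<close>

lemma is_weierstrass_sigma_unique:
  assumes "is_weierstrass_sigma g2 g3 f1" "is_weierstrass_sigma g2 g3 f2"
  shows "f1 = f2"
proof -
  obtain r1 h1 where 1: "r1 > 0" "h1 holomorphic_on UNIV" "\<And>z. f1 z = z * h1 z" "h1 0 = 1" "deriv h1 0 = 0"
    "\<And>z. z \<in> ball 0 r1 \<Longrightarrow> h1 z \<noteq> 0"
    "\<And>z. z \<in> ball 0 r1 - {0} \<Longrightarrow>
      (deriv (deriv (\<lambda>z. - deriv h1 z / h1 z)) z - 2 / z ^ 3)\<^sup>2
        = 4 * (deriv (\<lambda>z. - deriv h1 z / h1 z) z + 1 / z\<^sup>2) ^ 3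
          - g2 * (deriv (\<lambda>z. - deriv h1 z / h1 z) z + 1 / z\<^sup>2) - g3"
    by (rule weierstrass_sigma_germ[OF assms(1)], rule that)
  obtain r2 h2 where 2: "r2 > 0" "h2 holomorphic_on UNIV" "\<And>z. f2 z = z * h2 z" "h2 0 = 1" "deriv h2 0 = 0"
    "\<And>z. z \<in> ball 0 r2 \<Longrightarrow> h2 z \<noteq> 0"
    "\<And>z. z \<in> ball 0 r2 - {0} \<Longrightarrow>
      (deriv (deriv (\<lambda>z. - deriv h2 z / h2 z)) z - 2 / z ^ 3)\<^sup>2
        = 4 * (deriv (\<lambda>z. - deriv h2 z / h2 z) z + 1 / z\<^sup>2) ^ 3
          - g2 * (deriv (\<lambda>z. - deriv h2 z / h2 z) z + 1 / z\<^sup>2) - g3"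
    by (rule weierstrass_sigma_germ[OF assms(2)], rule that)
  define r where "r = min r1 r2"
  have r: "r > 0" "ball 0 r \<subseteq> ball (0::complex) r1" "ball 0 r \<subseteq> ball (0::complex) r2"
    using 1(1) 2(1) by (auto simp: r_def)
  define e1 where "e1 = (\<lambda>z. - deriv h1 z / h1 z)"
  define e2 where "e2 = (\<lambda>z. - deriv h2 z / h2 z)"
  have dh: "deriv h1 holomorphic_on UNIV" "deriv h2 holomorphic_on UNIV"
    by (intro holomorphic_deriv 1 2 open_UNIV)+
  have nz: "h1 z \<noteq> 0" "h2 z \<noteq> 0" if "z \<in> ball 0 r" for z
    using that r 1(6) 2(6) by auto
  have holo: "e1 holomorphic_on ball 0 r" "e2 holomorphic_on ball 0 r"
    unfolding e1_def e2_def using nz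
    by (auto intro!: holomorphic_intros intro: holomorphic_on_subset[OF 1(2)] holomorphic_on_subset[OF 2(2)]
        holomorphic_on_subset[OF dh(1)] holomorphic_on_subset[OF dh(2)])
  have q: "deriv e1 z = deriv e2 z" if "z \<in> ball 0 r" for z
  proof (rule wp_regular_part_unique[OF _ _ _ that])
    show "deriv e1 holomorphic_on ball 0 r" "deriv e2 holomorphic_on ball 0 r"
      by (intro holomorphic_deriv holo open_ball)+
    show "(deriv q z - 2 / z ^ 3)\<^sup>2 = 4 * (q z + 1 / z\<^sup>2) ^ 3 - g2 * (q z + 1 / z\<^sup>2) - g3"
      if "q \<in> {deriv e1, deriv e2}" "z \<in> ball 0 r - {0}" for q z
      using that r 1(7)[folded e1_def] 2(7)[folded e2_def] by auto
  qed
  have "\<exists>c. \<forall>z\<in>ball 0 r. e1 z - e2 z = c"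
  proof (rule has_field_derivative_zero_constant)
    fix z :: complex assume z: "z \<in> ball 0 r"
    have "((\<lambda>z. e1 z - e2 z) has_field_derivative deriv e1 z - deriv e2 z) (at z)"
      using z by (intro DERIV_diff holomorphic_derivI[OF holo(1)] holomorphic_derivI[OF holo(2)]) auto
    then show "((\<lambda>z. e1 z - e2 z) has_field_derivative 0) (at z within ball 0 r)"
      using q[OF z] by (simp add: has_field_derivative_at_within)
  qed auto
  then obtain c where c: "\<And>z. z \<in> ball 0 r \<Longrightarrow> e1 z - e2 z = c" by blast
  have "c = 0" using c[of 0] r(1) 1(5) 2(5) by (simp add: e1_def e2_def)
  have "h1 z = h2 z" if z: "z \<in> ball 0 r" for z
  proof -
    have "h1 z * h2 0 = h1 0 * h2 z"
    proof (rule proportional_if_wronskian_zero[OF holomorphic_on_subset[OF 1(2) subset_UNIV]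
          holomorphic_on_subset[OF 2(2) subset_UNIV] open_ball connected_ball _ _ _ z])
      fix u :: complex assume u: "u \<in> ball 0 r"
      show "deriv h1 u * h2 u = h1 u * deriv h2 u"
        using c[OF u] \<open>c = 0\<close> nz[OF u] by (simp add: e1_def e2_def field_simps)
    qed (simp_all add: r(1) 2(4))
    then show ?thesis by (simp add: 1(4) 2(4))
  qed
  then have "h1 = h2"
    using entire_eqI[OF 1(2) 2(2) r(1)] by blast
  then show ?thesis
    by (intro ext) (simp add: 1(3) 2(3))
qed

section \<open>The entire sigma function\<close>

text \<open>Joint holomorphy at a point: a complex-linear Frechet derivative.\<close>

definition holo3 :: "(complex \<times> complex \<times> complex \<Rightarrow> complex) \<Rightarrow> complex \<times> complex \<times> complex \<Rightarrow> bool" where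
  "holo3 F x \<longleftrightarrow>
     (\<exists>a b c. (F has_derivative (\<lambda>v. a * fst v + b * fst (snd v) + c * snd (snd v))) (at x))"

section \<open>Closure properties of joint holomorphy\<close>

lemma holo3_const: "holo3 (\<lambda>_. k) x"
  unfolding holo3_def by (intro exI[of _ 0]) simp

lemma holo3_proj: "holo3 fst x" "holo3 (\<lambda>x. fst (snd x)) x" "holo3 (\<lambda>x. snd (snd x)) x"
proof -
  show "holo3 fst x"
    unfolding holo3_def by (rule exI[of _ 1], rule exI[of _ 0], rule exI[of _ 0])
      (auto intro!: derivative_eq_intros)
  show "holo3 (\<lambda>x. fst (snd x)) x"
    unfolding holo3_def by (rule exI[of _ 0], rule exI[of _ 1], rule exI[of _ 0])
      (auto intro!: derivative_eq_intros)
  show "holo3 (\<lambda>x. snd (snd x)) x"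
    unfolding holo3_def by (rule exI[of _ 0], rule exI[of _ 0], rule exI[of _ 1])
      (auto intro!: derivative_eq_intros)
qed

lemma holo3_mult:
  assumes "holo3 F x" "holo3 G x"
  shows "holo3 (\<lambda>x. F x * G x) x"
proof -
  from assms obtain a b c a' b' c' where
    "(F has_derivative (\<lambda>v. a * fst v + b * fst (snd v) + c * snd (snd v))) (at x)"
    "(G has_derivative (\<lambda>v. a' * fst v + b' * fst (snd v) + c' * snd (snd v))) (at x)"
    unfolding holo3_def by blast
  from has_derivative_mult[OF this] show ?thesis
    unfolding holo3_def
    by (intro exI[of _ "F x * a' + a * G x"] exI[of _ "F x * b' + b * G x"] exI[of _ "F x * c' + c * G x"])
      (simp add: algebra_simps)
qed

text \<open>The chain rule for an outer function of two variables; a unary outer function such as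
  exp is covered by q = 0.\<close>

lemma holo3_compose2:
  assumes "holo3 F x" "holo3 G x"
    and "((\<lambda>(u, v). H u v) has_derivative (\<lambda>(h, k). p * h + q * k)) (at (F x, G x))"
  shows "holo3 (\<lambda>x. H (F x) (G x)) x"
proof -
  from assms obtain a b c a' b' c' where
    "(F has_derivative (\<lambda>v. a * fst v + b * fst (snd v) + c * snd (snd v))) (at x)"
    "(G has_derivative (\<lambda>v. a' * fst v + b' * fst (snd v) + c' * snd (snd v))) (at x)"
    unfolding holo3_def by blast
  from has_derivative_compose[OF has_derivative_Pair[OF this] assms(3)] show ?thesis
    unfolding holo3_def
    by (intro exI[of _ "p * a + q * a'"] exI[of _ "p * b + q * b'"] exI[of _ "p * c + q * c'"])
      (simp add: algebra_simps)
qed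

lemma holo3_add:
  assumes "holo3 F x" "holo3 G x"
  shows "holo3 (\<lambda>x. F x + G x) x"
  using assms
  by (rule holo3_compose2[where H = "(+)" and p = 1 and q = 1])
    (auto simp: case_prod_beta intro!: derivative_eq_intros)

lemma holo3_power: "holo3 F x \<Longrightarrow> holo3 (\<lambda>x. F x ^ n) x"
  by (induction n) (auto intro: holo3_const holo3_mult)

lemma holo3_minus: "holo3 F x \<Longrightarrow> holo3 (\<lambda>x. - F x) x"
  using holo3_mult[OF holo3_const[of "- 1"], of F x] by simp

lemma holo3_diff: "holo3 F x \<Longrightarrow> holo3 G x \<Longrightarrow> holo3 (\<lambda>x. F x - G x) x"
  using holo3_add[OF _ holo3_minus] by simp

lemma holo3_divide_const: "holo3 F x \<Longrightarrow> holo3 (\<lambda>x. F x / k) x"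
  using holo3_mult[OF _ holo3_const[of "1 / k"], of F x] by simp

lemma holo3_exp:
  assumes "holo3 F x"
  shows "holo3 (\<lambda>x. exp (F x)) x"
proof (rule holo3_compose2[where H = "\<lambda>u v. exp u" and p = "exp (F x)" and q = 0, OF assms assms])
  have "(fst has_derivative fst) (at (F x, F x))"
    by (auto intro!: derivative_eq_intros)
  from has_derivative_compose[OF this, of exp "(*) (exp (F x))"]
  have "((\<lambda>p. exp (fst p)) has_derivative (\<lambda>v. exp (F x) * fst v)) (at (F x, F x))"
    using DERIV_exp[of "F x"] by (simp add: has_field_derivative_def)
  then show "((\<lambda>(u, v). exp u) has_derivative (\<lambda>(h, k). exp (F x) * h + 0 * k)) (at (F x, F x))"
    unfolding case_prod_beta mult_zero_left add_0_right .
qed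

lemmas holo3_intros = holo3_const holo3_proj holo3_mult holo3_add holo3_power holo3_minus holo3_diff
  holo3_divide_const holo3_exp

lemma holo3_transform:
  assumes "holo3 F x" "open S" "x \<in> S" "\<And>y. y \<in> S \<Longrightarrow> F y = G y"
  shows "holo3 G x"
  using assms has_derivative_transform_within_open unfolding holo3_def by blast

text \<open>Composition with the three coordinate lines through the point identifies the
  coefficients of the Frechet derivative with the partial derivatives.\<close>

lemma holo3_partial_derivatives:
  assumes "holo3 (\<lambda>(z, x, y). F z x y) (z, x, y)"
  shows "((\<lambda>(z, x, y). F z x y) has_derivative (\<lambda>(u, v, w).
      deriv (\<lambda>t. F t x y) z * u + deriv (\<lambda>t. F z t y) x * v + deriv (\<lambda>t. F z x t) y * w)) (at (z, x, y))"
    and "(\<lambda>t. F t x y) field_differentiable at z" "(\<lambda>t. F z t y) field_differentiable at x"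
    "(\<lambda>t. F z x t) field_differentiable at y"
proof -
  from assms obtain a b c where
    D: "((\<lambda>(z, x, y). F z x y) has_derivative (\<lambda>v. a * fst v + b * fst (snd v) + c * snd (snd v))) (at (z, x, y))"
    unfolding holo3_def by blast
  have 1: "((\<lambda>t. F t x y) has_field_derivative a) (at z)"
    unfolding has_field_derivative_def
    using has_derivative_compose[where f = "\<lambda>t. (t, x, y)", OF _ D, of "\<lambda>h. (h, 0, 0)" UNIV]
    by (simp add: has_derivative_Pair)
  have 2: "((\<lambda>t. F z t y) has_field_derivative b) (at x)"
    unfolding has_field_derivative_def
    using has_derivative_compose[where f = "\<lambda>t. (z, t, y)", OF _ D, of "\<lambda>h. (0, h, 0)" UNIV]
    by (simp add: has_derivative_Pair)
  have 3: "((\<lambda>t. F z x t) has_field_derivative c) (at y)"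
    unfolding has_field_derivative_def
    using has_derivative_compose[where f = "\<lambda>t. (z, x, t)", OF _ D, of "\<lambda>h. (0, 0, h)" UNIV]
    by (simp add: has_derivative_Pair)
  show "((\<lambda>(z, x, y). F z x y) has_derivative (\<lambda>(u, v, w).
      deriv (\<lambda>t. F t x y) z * u + deriv (\<lambda>t. F z t y) x * v + deriv (\<lambda>t. F z x t) y * w)) (at (z, x, y))"
    using D unfolding DERIV_imp_deriv[OF 1] DERIV_imp_deriv[OF 2] DERIV_imp_deriv[OF 3] case_prod_beta .
  show "(\<lambda>t. F t x y) field_differentiable at z" "(\<lambda>t. F z t y) field_differentiable at x"
    "(\<lambda>t. F z x t) field_differentiable at y"
    using 1 2 3 by (auto simp: field_differentiable_def)
qed

lemma holo3_wp_series:
  assumes "holo3 X x" "holo3 Y x" "norm (X x) < 1" "norm (Y x) < 1" "\<And>n. norm (w n) \<le> 2 * real (Suc n)"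
  shows "holo3 (\<lambda>x. wp_series w (X x) (Y x)) x"
proof -
  obtain a b where "((\<lambda>(x, y). wp_series w x y) has_derivative (\<lambda>(h, k). a * h + b * k)) (at (X x, Y x))"
    by (rule has_derivative_wp_series[OF assms(5,3,4)])
  from holo3_compose2[OF assms(1,2) this] show ?thesis .
qed

lemma holo3_local:
  assumes Z: "holo3 Z x" and r: "norm (Z x) < sigma_radius (fst (snd x)) (snd (snd x))"
  shows "holo3 (\<lambda>x. local_sigma (Z x) (fst (snd x)) (snd (snd x))) x"
    and "holo3 (\<lambda>x. local_p (Z x) (fst (snd x)) (snd (snd x))) x"
    and "holo3 (\<lambda>x. local_q (Z x) (fst (snd x)) (snd (snd x))) x"
  unfolding local_sigma_def local_p_def local_q_def
  using norm_scaled_invariants[OF less_imp_le[OF r]]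
  by (intro holo3_intros Z holo3_wp_series weights_le; simp)+

section \<open>Continuation by duplication\<close>

text \<open>The polynomial map that takes (s, p, q) at z to (s, p, q) at 2z, read off from the
  duplication formulas.\<close>

fun dup :: "complex \<Rightarrow> complex \<times> complex \<times> complex \<Rightarrow> complex \<times> complex \<times> complex" where
  "dup g2 (s, p, q) =
     (- s * q,
      - 2 * p * q\<^sup>2 + (6 * p\<^sup>2 - g2 / 2 * s ^ 4)\<^sup>2 / 4,
      q ^ 4 - 3 * p * (6 * p\<^sup>2 - g2 / 2 * s ^ 4) * q\<^sup>2 + (6 * p\<^sup>2 - g2 / 2 * s ^ 4) ^ 3 / 4)"

definition local_triple :: "complex \<Rightarrow> complex \<Rightarrow> complex \<Rightarrow> complex \<times> complex \<times> complex" where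
  "local_triple z g2 g3 = (local_sigma z g2 g3, local_p z g2 g3, local_q z g2 g3)"

lemma dup_local_triple:
  assumes "norm z < sigma_radius g2 g3 / 2"
  shows "dup g2 (local_triple z g2 g3) = local_triple (2 * z) g2 g3"
proof -
  interpret sigma_germ "sigma_radius g2 g3" g2 g3 "\<lambda>z. local_sigma z g2 g3" "local_e g2 g3"
    by (rule local_sigma_germ(1))
  have "z \<in> ball 0 (sigma_radius g2 g3)" "2 * z \<in> ball 0 (sigma_radius g2 g3)" 
    "z \<in> ball 0 (sigma_radius g2 g3 / 2)"
    using assms sigma_radius_pos[of g2 g3] by (auto simp: norm_mult)
  then show ?thesis
    using duplication[of z] local_sigma_germ(2,3)[of z g2 g3] local_sigma_germ(2,3)[of "2 * z" g2 g3]
    by (simp add: local_triple_def)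
qed

text \<open>The choice of \<open>n\<close> is immaterial as long as \<open>z / 2\<^sup>n\<close> lies in the domain of the germs.\<close>

definition sigma_triple :: "complex \<Rightarrow> complex \<Rightarrow> complex \<Rightarrow> complex \<times> complex \<times> complex" where
  "sigma_triple z g2 g3 = (let n = LEAST n. norm z < 2 ^ n * sigma_radius g2 g3
     in (dup g2 ^^ n) (local_triple (z / 2 ^ n) g2 g3))"

text \<open>Each further halving of the argument is undone by one \<open>dup\<close>. The least
  exponent jumps as z and the invariants vary; a fixed n can be used on a whole
  neighbourhood.\<close>

lemma sigma_triple_eq:
  assumes "norm z < 2 ^ n * sigma_radius g2 g3"
  shows "sigma_triple z g2 g3 = (dup g2 ^^ n) (local_triple (z / 2 ^ n) g2 g3)"
proof -
  define m where "m = (LEAST n. norm z < 2 ^ n * sigma_radius g2 g3)"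
  have m: "norm z < 2 ^ m * sigma_radius g2 g3" "m \<le> n"
    unfolding m_def using assms by (auto intro: LeastI Least_le)
  have "(dup g2 ^^ (m + k)) (local_triple (z / 2 ^ (m + k)) g2 g3)
      = (dup g2 ^^ m) (local_triple (z / 2 ^ m) g2 g3)" for k
  proof (induction k)
    case (Suc k)
    have "norm z < 2 ^ (m + k) * sigma_radius g2 g3"
      using m(1) by (rule less_le_trans)
        (intro mult_right_mono power_increasing less_imp_le[OF sigma_radius_pos]; simp)
    then have "norm (z / 2 ^ (m + Suc k)) < sigma_radius g2 g3 / 2"
      by (simp add: norm_divide norm_power field_simps)
    from dup_local_triple[OF this]
    have "dup g2 (local_triple (z / 2 ^ (m + Suc k)) g2 g3) = local_triple (z / 2 ^ (m + k)) g2 g3"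
      by simp
    then show ?case
      using Suc.IH by (simp only: add_Suc_right funpow_Suc_right o_apply)
  qed simp
  from this[of "n - m"] show ?thesis
    using m(2) by (simp add: sigma_triple_def Let_def m_def)
qed

text \<open>\<open>dup\<close> is polynomial in g2 and its arguments. The functions S, P, Q are
  generalised because the induction peels off the innermost \<open>dup\<close>.\<close>

lemma holo3_dup_iterate:
  assumes "holo3 S x" "holo3 P x" "holo3 Q x"
  shows "holo3 (\<lambda>x. fst ((dup (fst (snd x)) ^^ n) (S x, P x, Q x))) x
    \<and> holo3 (\<lambda>x. fst (snd ((dup (fst (snd x)) ^^ n) (S x, P x, Q x)))) x
    \<and> holo3 (\<lambda>x. snd (snd ((dup (fst (snd x)) ^^ n) (S x, P x, Q x)))) x"
  using assms
proof (induction n arbitrary: S P Q)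
  case (Suc n)
  show ?case
    unfolding funpow_Suc_right o_apply dup.simps
    by (rule Suc.IH; intro holo3_intros Suc.prems)
qed simp

text \<open>Near x one exponent n serves for all points, and there the triple is a fixed iterate of
  \<open>dup\<close> applied to jointly holomorphic germs.\<close>

lemma sigma_triple_holo3:
  shows "holo3 (\<lambda>(z, g2, g3). fst (sigma_triple z g2 g3)) x"
    and "holo3 (\<lambda>(z, g2, g3). fst (snd (sigma_triple z g2 g3))) x"
    and "holo3 (\<lambda>(z, g2, g3). snd (snd (sigma_triple z g2 g3))) x"
proof -
  obtain n where n: "norm (fst x) / sigma_radius (fst (snd x)) (snd (snd x)) < 2 ^ n"
    using real_arch_pow[of 2] by auto
  define S :: "(complex \<times> complex \<times> complex) set"
    where "S = {x. norm (fst x) < 2 ^ n * sigma_radius (fst (snd x)) (snd (snd x))}"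
  \<comment> \<open>Multiplying out the radius leaves a strict inequality between continuous
    functions, from which openness is immediate.\<close>
  have S_eq: "S = {x :: complex \<times> complex \<times> complex. norm (fst x) * (1 + norm (fst (snd x)) + norm (snd (snd x))) < 2 ^ n}"
  proof -
    have "1 + norm u + norm v > 0" for u v :: complex
      using norm_ge_zero[of u] norm_ge_zero[of v] by linarith
    then show ?thesis by (simp add: S_def sigma_radius_def pos_less_divide_eq)
  qed
  have S: "open S"
    unfolding S_eq by (intro open_Collect_less continuous_intros)
  have x: "x \<in> S"
    using n sigma_radius_pos[of "fst (snd x)" "snd (snd x)"] by (simp add: S_def field_simps)
  let ?g2 = "\<lambda>x :: complex \<times> complex \<times> complex. fst (snd x)" and ?g3 = "\<lambda>x :: complex \<times> complex \<times> complex. snd (snd x)"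
  have "norm (fst x / 2 ^ n) < sigma_radius (?g2 x) (?g3 x)"
    using x by (simp add: S_def norm_divide norm_power field_simps)
  note local = holo3_local[OF holo3_divide_const[OF holo3_proj(1)] this]
  have eq: "(dup (?g2 y) ^^ n) (local_sigma (fst y / 2 ^ n) (?g2 y) (?g3 y),
      local_p (fst y / 2 ^ n) (?g2 y) (?g3 y), local_q (fst y / 2 ^ n) (?g2 y) (?g3 y))
    = sigma_triple (fst y) (?g2 y) (?g3 y)" if "y \<in> S" for y
    using sigma_triple_eq[of "fst y" n "?g2 y" "?g3 y"] that by (simp add: S_def local_triple_def)
  note it = holo3_dup_iterate[OF local, of n]
  show "holo3 (\<lambda>(z, g2, g3). fst (sigma_triple z g2 g3)) x"
    by (rule holo3_transform[OF conjunct1[OF it] S x]) (simp only: eq case_prod_beta)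
  show "holo3 (\<lambda>(z, g2, g3). fst (snd (sigma_triple z g2 g3))) x"
    by (rule holo3_transform[OF conjunct1[OF conjunct2[OF it]] S x]) (simp only: eq case_prod_beta)
  show "holo3 (\<lambda>(z, g2, g3). snd (snd (sigma_triple z g2 g3))) x"
    by (rule holo3_transform[OF conjunct2[OF conjunct2[OF it]] S x]) (simp only: eq case_prod_beta)
qed

lemma entire_sigma:
  fixes g2 g3
  defines "S \<equiv> \<lambda>z. fst (sigma_triple z g2 g3)"
    and "P \<equiv> \<lambda>z. fst (snd (sigma_triple z g2 g3))"
    and "Q \<equiv> \<lambda>z. snd (snd (sigma_triple z g2 g3))"
  shows "S holomorphic_on UNIV" "P holomorphic_on UNIV" "Q holomorphic_on UNIV"
    and "z \<in> ball 0 (sigma_radius g2 g3) \<Longrightarrow> S z = local_sigma z g2 g3"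
    and "z \<in> ball 0 (sigma_radius g2 g3) \<Longrightarrow> P z = local_p z g2 g3"
    and "z \<in> ball 0 (sigma_radius g2 g3) \<Longrightarrow> Q z = local_q z g2 g3"
proof -
  show "S holomorphic_on UNIV" "P holomorphic_on UNIV" "Q holomorphic_on UNIV"
    unfolding S_def P_def Q_def
    by (auto simp: holomorphic_on_def intro!: holo3_partial_derivatives(2) sigma_triple_holo3)
  show "S z = local_sigma z g2 g3" "P z = local_p z g2 g3" "Q z = local_q z g2 g3"
    if "z \<in> ball 0 (sigma_radius g2 g3)"
    using sigma_triple_eq[of z 0 g2 g3] that by (simp_all add: S_def P_def Q_def local_triple_def)
qed

section \<open>Global identities by analytic continuation\<close>

lemma deriv_eq_on_open:
  assumes "open S" "z \<in> S" "\<And>u. u \<in> S \<Longrightarrow> f u = g u"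
  shows "deriv f z = deriv g z"
  using assms by (intro deriv_cong_ev) (auto simp: eventually_nhds)

text \<open>All are identities between entire functions that hold near 0 by the results on
  germs.\<close>

lemma sigma_triple_relations:
  fixes g2 g3
  defines "S \<equiv> \<lambda>z. fst (sigma_triple z g2 g3)"
    and "P \<equiv> \<lambda>z. fst (snd (sigma_triple z g2 g3))"
    and "Q \<equiv> \<lambda>z. snd (snd (sigma_triple z g2 g3))"
  shows "S (- z) = - S z" and "deriv S 0 = 1"
    and "P z = (deriv S z)\<^sup>2 - S z * deriv (deriv S) z"
    and "Q z = deriv P z * S z - 2 * P z * deriv S z"
    and "(Q z)\<^sup>2 = 4 * P z ^ 3 - g2 * P z * S z ^ 4 - g3 * S z ^ 6"
    and "S (u + v) * S (u - v) = (S u)\<^sup>2 * P v - (S v)\<^sup>2 * P u"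
proof -
  note ent = entire_sigma[where ?g2.0 = g2 and ?g3.0 = g3, folded S_def P_def Q_def]
  note holo = ent(1-3)
  define r where "r = sigma_radius g2 g3"
  let ?s = "\<lambda>z. local_sigma z g2 g3"
  interpret sigma_germ r g2 g3 ?s "local_e g2 g3"
    unfolding r_def by (rule local_sigma_germ(1))
  have r: "r > 0" by (simp add: r_def sigma_radius_pos)
  have S_eq: "S z = ?s z" if "z \<in> ball 0 r" for z using ent(4)[of z] that by (simp add: r_def S_def)
  have P_eq: "P z = p z" if "z \<in> ball 0 r" for z
    using ent(5)[of z] local_sigma_germ(2)[of z g2 g3] that by (simp add: r_def P_def)
  have Q_eq: "Q z = q z" if "z \<in> ball 0 r" for z
    using ent(6)[of z] local_sigma_germ(3)[of z g2 g3] that by (simp add: r_def Q_def)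
  have dS: "deriv S z = deriv ?s z" "deriv P z = deriv p z" if "z \<in> ball 0 r" for z
    using that by (auto intro!: deriv_eq_on_open[OF open_ball] S_eq P_eq)
  have ddS: "deriv (deriv S) z = deriv (deriv ?s) z" if "z \<in> ball 0 r" for z
    using that by (auto intro!: deriv_eq_on_open[OF open_ball] dS)
  have holo_d: "deriv S holomorphic_on UNIV" "deriv P holomorphic_on UNIV" "deriv (deriv S) holomorphic_on UNIV"
    by (intro holomorphic_deriv holo open_UNIV)+
  have holo_comp: "(\<lambda>z. S (f z)) holomorphic_on UNIV" if "f holomorphic_on UNIV" for f
    using holomorphic_on_compose_gen[OF that holo(1)] by (simp add: o_def)
  have "(\<lambda>z. S (- z)) = (\<lambda>z. - S z)"
    by (rule entire_eqI[OF _ _ r]) (auto intro!: holomorphic_intros holo holo_comp simp: S_eq s_odd)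
  then show "S (- z) = - S z" by meson
  show "deriv S 0 = 1" using dS(1)[of 0] r deriv_s_0 by simp
  have "P = (\<lambda>z. (deriv S z)\<^sup>2 - S z * deriv (deriv S) z)"
    by (rule entire_eqI[OF _ _ r])
      (auto intro!: holomorphic_intros holo holo_d simp: S_eq P_eq dS ddS p_def)
  then show "P z = (deriv S z)\<^sup>2 - S z * deriv (deriv S) z" by meson
  have "Q = (\<lambda>z. deriv P z * S z - 2 * P z * deriv S z)"
    by (rule entire_eqI[OF _ _ r])
      (auto intro!: holomorphic_intros holo holo_d simp: S_eq P_eq Q_eq dS ddS q_def)
  then show "Q z = deriv P z * S z - 2 * P z * deriv S z" by meson
  have "(\<lambda>z. (Q z)\<^sup>2) = (\<lambda>z. 4 * P z ^ 3 - g2 * P z * S z ^ 4 - g3 * S z ^ 6)"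
    by (rule entire_eqI[OF _ _ r])
      (auto intro!: holomorphic_intros holo simp: S_eq P_eq Q_eq cubic_relation)
  then show "(Q z)\<^sup>2 = 4 * P z ^ 3 - g2 * P z * S z ^ 4 - g3 * S z ^ 6" by meson
  have r2: "r / 2 > 0" using r by simp
  have small: "S (u + v) * S (u - v) = (S u)\<^sup>2 * P v - (S v)\<^sup>2 * P u"
    if "u \<in> ball 0 (r / 2)" "v \<in> ball 0 (r / 2)" for u v
  proof -
    have n: "norm u + norm v < r" using that by simp
    then have "norm (u + v) < r" "norm (u - v) < r" "norm u < r" "norm v < r"
      using norm_triangle_ineq[of u v] norm_triangle_ineq4[of u v] that r by auto
    then show ?thesis
      using sigma_addition[OF n] by (simp add: S_eq P_eq)
  qed
  \<comment> \<open>The addition formula is continued one variable at a time: first in u with v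
    small, then in v with u arbitrary.\<close>
  have half: "S (u + v) * S (u - v) = (S u)\<^sup>2 * P v - (S v)\<^sup>2 * P u" if v: "v \<in> ball 0 (r / 2)" for u v
  proof -
    have "(\<lambda>u. S (u + v) * S (u - v)) = (\<lambda>u. (S u)\<^sup>2 * P v - (S v)\<^sup>2 * P u)"
      by (rule entire_eqI[OF _ _ r2]) (use small v in \<open>auto intro!: holomorphic_intros holo holo_comp\<close>)
    then show ?thesis by meson
  qed
  have "(\<lambda>v. S (u + v) * S (u - v)) = (\<lambda>v. (S u)\<^sup>2 * P v - (S v)\<^sup>2 * P u)"
    by (rule entire_eqI[OF _ _ r2]) (use half in \<open>auto intro!: holomorphic_intros holo holo_comp\<close>)
  then show "S (u + v) * S (u - v) = (S u)\<^sup>2 * P v - (S v)\<^sup>2 * P u" by meson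
qed

text \<open>Off the zeros of S, wp is P / S^2 and its derivative is Q / S^3, so the required
  equation is the cubic relation divided by S^6.\<close>

lemma sigma_triple_is_weierstrass_sigma:
  "is_weierstrass_sigma g2 g3 (\<lambda>z. fst (sigma_triple z g2 g3))"
proof -
  define S where "S = (\<lambda>z. fst (sigma_triple z g2 g3))"
  define P where "P = (\<lambda>z. fst (snd (sigma_triple z g2 g3)))"
  define Q where "Q = (\<lambda>z. snd (snd (sigma_triple z g2 g3)))"
  note holo = entire_sigma(1-3)[where ?g2.0 = g2 and ?g3.0 = g3, folded S_def P_def Q_def]
  have rel: "P z = (deriv S z)\<^sup>2 - S z * deriv (deriv S) z"
    "Q z = deriv P z * S z - 2 * P z * deriv S z"
    "(Q z)\<^sup>2 = 4 * P z ^ 3 - g2 * P z * S z ^ 4 - g3 * S z ^ 6"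
    "S (- z) = - S z" "deriv S 0 = 1" for z
    unfolding S_def P_def Q_def by (rule sigma_triple_relations)+
  have dS: "(S has_field_derivative deriv S z) (at z)" "(P has_field_derivative deriv P z) (at z)"
    "(deriv S has_field_derivative deriv (deriv S) z) (at z)" for z
    by (rule holomorphic_derivI[OF holo(1) open_UNIV UNIV_I] holomorphic_derivI[OF holo(2) open_UNIV UNIV_I]
        holomorphic_derivI[OF holomorphic_deriv[OF holo(1) open_UNIV] open_UNIV UNIV_I])+
  define U where "U = S -` (- {0})"
  have U: "open U"
    unfolding U_def by (intro open_vimage holomorphic_on_imp_continuous_on holo open_Compl closed_singleton)
  have wp: "wp_of_sigma S z = P z / (S z)\<^sup>2" if "z \<in> U" for z
  proof -
    have "(log_deriv S has_field_derivative
        (deriv (deriv S) z * S z - deriv S z * deriv S z) / (S z * S z)) (at z)"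
      unfolding log_deriv_def[abs_def] using that by (intro DERIV_divide dS) (simp add: U_def)
    then have d: "deriv (log_deriv S) z = (deriv (deriv S) z * S z - deriv S z * deriv S z) / (S z * S z)"
      by (rule DERIV_imp_deriv)
    show ?thesis
      unfolding wp_of_sigma_def rel(1) d
      by (simp only: minus_divide_left minus_diff_eq power2_eq_square mult.commute)
  qed
  have dwp: "deriv (wp_of_sigma S) z = Q z / S z ^ 3" if z: "z \<in> U" for z
  proof -
    have nz: "S z \<noteq> 0" using z by (simp add: U_def)
    have "((\<lambda>z. (S z)\<^sup>2) has_field_derivative 2 * S z * deriv S z) (at z)"
      using dS(1)[of z] by (auto intro!: derivative_eq_intros)
    then have "((\<lambda>z. P z / (S z)\<^sup>2) has_field_derivative
        (deriv P z * (S z)\<^sup>2 - P z * (2 * S z * deriv S z)) / ((S z)\<^sup>2 * (S z)\<^sup>2)) (at z)"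
      using nz by (intro DERIV_divide dS) auto
    then have "deriv (\<lambda>z. P z / (S z)\<^sup>2) z =
        (deriv P z * (S z)\<^sup>2 - P z * (2 * S z * deriv S z)) / ((S z)\<^sup>2 * (S z)\<^sup>2)"
      by (rule DERIV_imp_deriv)
    also have "\<dots> = Q z / S z ^ 3"
      unfolding rel(2) using nz by (simp add: field_simps eval_nat_numeral)
    finally show ?thesis
      using deriv_eq_on_open[OF U z wp] by simp
  qed
  have "(deriv (wp_of_sigma S) z)\<^sup>2 = 4 * wp_of_sigma S z ^ 3 - g2 * wp_of_sigma S z - g3" if "S z \<noteq> 0" for z
  proof -
    have z: "z \<in> U" using that by (simp add: U_def)
    have "(Q z / S z ^ 3)\<^sup>2 = (4 * P z ^ 3 - g2 * P z * S z ^ 4 - g3 * S z ^ 6) / S z ^ 6"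
      by (simp add: power_divide rel(3) flip: power_mult)
    also have "\<dots> = 4 * (P z / (S z)\<^sup>2) ^ 3 - g2 * (P z / (S z)\<^sup>2) - g3"
      using that by (simp add: field_simps eval_nat_numeral)
    finally show ?thesis
      unfolding wp[OF z] dwp[OF z] .
  qed
  then show ?thesis
    using holo(1) rel(4,5) unfolding is_weierstrass_sigma_def S_def by blast
qed

lemma weierstrass_sigma_eq: "weierstrass_sigma z g2 g3 = fst (sigma_triple z g2 g3)"
proof -
  have "(THE f. is_weierstrass_sigma g2 g3 f) = (\<lambda>z. fst (sigma_triple z g2 g3))"
    using sigma_triple_is_weierstrass_sigma is_weierstrass_sigma_unique by blast
  then show ?thesis by (simp add: weierstrass_sigma_def)
qed

text \<open>Take the addition formula at (w, 2z) and (w, z). Eliminating P(w) leaves a combination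
  of P(z) and P(2z), which the formula at (2z, z) evaluates.\<close>

lemma weierstrass_sigma_three_term:
  fixes z w g2 g3
  defines "\<sigma> \<equiv> \<lambda>u. weierstrass_sigma u g2 g3"
  shows "(\<sigma> z)\<^sup>2 * \<sigma> (w + 2 * z) * \<sigma> (w - 2 * z) =
    (\<sigma> (2 * z))\<^sup>2 * \<sigma> (w + z) * \<sigma> (w - z) - (\<sigma> w)\<^sup>2 * \<sigma> (3 * z) * \<sigma> z"
proof -
  define P where "P = (\<lambda>z. fst (snd (sigma_triple z g2 g3)))"
  have add: "\<sigma> (u + v) * \<sigma> (u - v) = (\<sigma> u)\<^sup>2 * P v - (\<sigma> v)\<^sup>2 * P u" for u v
    unfolding \<sigma>_def P_def weierstrass_sigma_eq by (rule sigma_triple_relations(6))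
  have "\<sigma> (3 * z) * \<sigma> z = (\<sigma> (2 * z))\<^sup>2 * P z - (\<sigma> z)\<^sup>2 * P (2 * z)"
    using add[of "2 * z" z] by simp
  with add[of w "2 * z"] add[of w z] show ?thesis by algebra
qed

lemma weierstrass_sigma_has_derivative:
  "((\<lambda>(z, g2, g3). weierstrass_sigma z g2 g3) has_derivative (\<lambda>(u, v, w).
      deriv (\<lambda>t. weierstrass_sigma t g2 g3) z * u + deriv (\<lambda>t. weierstrass_sigma z t g3) g2 * v
      + deriv (\<lambda>t. weierstrass_sigma z g2 t) g3 * w)) (at (z, g2, g3))"
  and weierstrass_sigma_field_differentiable:
    "(\<lambda>t. weierstrass_sigma t g2 g3) field_differentiable at z"
    "(\<lambda>t. weierstrass_sigma z t g3) field_differentiable at g2"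
    "(\<lambda>t. weierstrass_sigma z g2 t) field_differentiable at g3"
proof -
  have "holo3 (\<lambda>(z, g2, g3). weierstrass_sigma z g2 g3) (z, g2, g3)"
    unfolding weierstrass_sigma_eq by (rule sigma_triple_holo3)
  from holo3_partial_derivatives[OF this]
  show "((\<lambda>(z, g2, g3). weierstrass_sigma z g2 g3) has_derivative (\<lambda>(u, v, w).
      deriv (\<lambda>t. weierstrass_sigma t g2 g3) z * u + deriv (\<lambda>t. weierstrass_sigma z t g3) g2 * v
      + deriv (\<lambda>t. weierstrass_sigma z g2 t) g3 * w)) (at (z, g2, g3))"
    "(\<lambda>t. weierstrass_sigma t g2 g3) field_differentiable at z"
    "(\<lambda>t. weierstrass_sigma z t g3) field_differentiable at g2"
    "(\<lambda>t. weierstrass_sigma z g2 t) field_differentiable at g3"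
    by blast+
qed

section \<open>Dual numbers and Somos-4\<close>

lemma dual_parts [simp]:
  "even_part 0 = 0" "odd_part 0 = 0" "even_part 1 = 1" "odd_part 1 = 0"
  "even_part (X + Y) = even_part X + even_part Y" "odd_part (X + Y) = odd_part X + odd_part Y"
  "even_part (X - Y) = even_part X - even_part Y" "odd_part (X - Y) = odd_part X - odd_part Y"
  "even_part (X * Y) = even_part X * even_part Y"
  "odd_part (X * Y) = even_part X * odd_part Y + odd_part X * even_part Y"
  by (simp_all add: zero_dual_def one_dual_def plus_dual_def minus_dual_def times_dual_def)

lemma of_nat_dual: "of_nat n = Dual (of_nat n) 0"
  by (induction n) (simp_all add: zero_dual_def one_dual_def plus_dual_def)

lemma numeral_dual_parts [simp]: "even_part (numeral k) = numeral k" "odd_part (numeral k) = 0"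
  using arg_cong[OF of_nat_dual[of "numeral k"], of even_part]
    arg_cong[OF of_nat_dual[of "numeral k"], of odd_part] by simp_all

lemma of_int_dual_parts [simp]: "even_part (of_int n) = of_int n" "odd_part (of_int n) = 0"
proof -
  have "of_int n = Dual (of_int n) 0"
    by (cases n rule: int_cases2) (simp_all add: of_nat_dual uminus_dual_def)
  then show "even_part (of_int n) = of_int n" "odd_part (of_int n) = 0" by simp_all
qed

text \<open>The odd part is written as the even part times n (b / a), a logarithmic derivative. This
  avoids the exponent n - 1 and is the shape of the component formula.\<close>

lemma power_dual:
  assumes "a \<noteq> 0"
  shows "Dual a b ^ n = Dual (a ^ n) (of_nat n * a ^ n * (b / a))"
  using assms by (induction n) (simp_all add: one_dual_def times_dual_def field_simps)

lemma power_int_dual: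
  assumes "a \<noteq> 0"
  shows "Dual a b powi n = Dual (a powi n) (of_int n * a powi n * (b / a))"
proof (cases n rule: int_cases2)
  case (nonneg k)
  then show ?thesis using power_dual[OF assms] by simp
next
  case (nonpos k)
  have "Dual a b powi n = Dual (inverse a) (- b / a\<^sup>2) ^ k"
    using nonpos assms by (cases "k = 0") (simp_all add: power_int_def inverse_dual_def)
  also have "\<dots> = Dual (inverse a ^ k) (of_nat k * inverse a ^ k * (- b / a\<^sup>2 / inverse a))"
    using assms by (intro power_dual) simp
  also have "\<dots> = Dual (a powi n) (of_int n * a powi n * (b / a))"
    using nonpos assms by (simp add: power_int_minus power_inverse power2_eq_square)
  finally show ?thesis .
qed

lemma dual_unit_power_int:
  assumes "X \<in> dual_units"
  shows "X powi (m + n) = X powi m * X powi n" "inverse (X powi n) = X powi (- n)"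
proof -
  obtain a b where X: "X = Dual a b" and a: "a \<noteq> 0"
    using assms by (cases X) (auto simp: dual_units_def)
  show "X powi (m + n) = X powi m * X powi n"
    unfolding X power_int_dual[OF a] using a
    by (simp add: times_dual_def power_int_add algebra_simps)
  show "inverse (X powi n) = X powi (- n)"
    unfolding X power_int_dual[OF a] using a
    by (simp add: inverse_dual_def power_int_minus field_simps power2_eq_square)
qed

section \<open>Transfer of identities by first-order jets\<close>

text \<open>X records the value and the first derivative of a curve at parameter 0. Products of dual
  numbers then follow the product rule.\<close>

definition jet :: "(complex \<Rightarrow> complex) \<Rightarrow> dual \<Rightarrow> bool" where
  "jet f X \<longleftrightarrow> f 0 = even_part X \<and> (f has_field_derivative odd_part X) (at 0)"

lemma jet_mult: "jet f X \<Longrightarrow> jet g Y \<Longrightarrow> jet (\<lambda>t. f t * g t) (X * Y)"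
  unfolding jet_def by (auto intro!: derivative_eq_intros simp: mult.commute)

lemma jet_diff: "jet f X \<Longrightarrow> jet g Y \<Longrightarrow> jet (\<lambda>t. f t - g t) (X - Y)"
  unfolding jet_def by (auto intro!: derivative_eq_intros)

lemma jet_unique: "jet f X \<Longrightarrow> jet f Y \<Longrightarrow> X = Y"
  unfolding jet_def by (auto intro: dual.expand dest: DERIV_unique)

text \<open>The chain rule along the line through the even parts in the direction of the odd parts.
  It uses the joint derivative of sigma, whose value in that direction is the Taylor coefficient of
  \<open>dual_eval3\<close>.\<close>

lemma jet_dual_sigma:
  "jet (\<lambda>t. weierstrass_sigma (even_part Z + t * odd_part Z) (even_part G2 + t * odd_part G2)
     (even_part G3 + t * odd_part G3)) (dual_sigma Z G2 G3)"
proof -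
  let ?c = "\<lambda>t. (even_part Z + t * odd_part Z, even_part G2 + t * odd_part G2, even_part G3 + t * odd_part G3)"
  have c: "(?c has_derivative (\<lambda>h. (h * odd_part Z, h * odd_part G2, h * odd_part G3))) (at 0)"
    by (auto intro!: derivative_eq_intros)
  have d: "((\<lambda>(z, g2, g3). weierstrass_sigma z g2 g3) has_derivative (\<lambda>(u, v, w).
      deriv (\<lambda>t. weierstrass_sigma t (even_part G2) (even_part G3)) (even_part Z) * u
      + deriv (\<lambda>t. weierstrass_sigma (even_part Z) t (even_part G3)) (even_part G2) * v
      + deriv (\<lambda>t. weierstrass_sigma (even_part Z) (even_part G2) t) (even_part G3) * w)) (at (?c 0))"
    using weierstrass_sigma_has_derivative by simp
  have "((\<lambda>t. weierstrass_sigma (even_part Z + t * odd_part Z) (even_part G2 + t * odd_part G2)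
     (even_part G3 + t * odd_part G3)) has_field_derivative odd_part (dual_sigma Z G2 G3)) (at 0)"
  proof (rule has_derivative_imp_has_field_derivative)
    show "((\<lambda>t. weierstrass_sigma (even_part Z + t * odd_part Z) (even_part G2 + t * odd_part G2)
      (even_part G3 + t * odd_part G3)) has_derivative (\<lambda>h. case (h * odd_part Z, h * odd_part G2, h * odd_part G3) of (u, v, w) \<Rightarrow>
      deriv (\<lambda>t. weierstrass_sigma t (even_part G2) (even_part G3)) (even_part Z) * u
      + deriv (\<lambda>t. weierstrass_sigma (even_part Z) t (even_part G3)) (even_part G2) * v
      + deriv (\<lambda>t. weierstrass_sigma (even_part Z) (even_part G2) t) (even_part G3) * w)) (at 0)"
      using has_derivative_compose[OF c d] by simp
  qed (simp add: dual_sigma_def dual_eval3_def Let_def algebra_simps)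
  then show ?thesis
    by (simp add: jet_def dual_sigma_def dual_eval3_def Let_def)
qed

text \<open>By the complex identity at every t, the two sides are jets of one and the same function
  of t, so they coincide.\<close>

lemma dual_sigma_three_term:
  fixes Z W G2 G3
  defines "S \<equiv> \<lambda>U. dual_sigma U G2 G3"
  shows "S Z * S Z * S (W + 2 * Z) * S (W - 2 * Z) =
    S (2 * Z) * S (2 * Z) * S (W + Z) * S (W - Z) - S W * S W * S (3 * Z) * S Z"
proof (rule jet_unique)
  define f where "f U t = weierstrass_sigma (even_part U + t * odd_part U) (even_part G2 + t * odd_part G2)
     (even_part G3 + t * odd_part G3)" for U t
  have f: "jet (f U) (S U)" for U
    unfolding f_def S_def by (rule jet_dual_sigma)
  show "jet (\<lambda>t. f Z t * f Z t * f (W + 2 * Z) t * f (W - 2 * Z) t) (S Z * S Z * S (W + 2 * Z) * S (W - 2 * Z))"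
    by (intro jet_mult f)
  have "jet (\<lambda>t. f (2 * Z) t * f (2 * Z) t * f (W + Z) t * f (W - Z) t - f W t * f W t * f (3 * Z) t * f Z t)
     (S (2 * Z) * S (2 * Z) * S (W + Z) * S (W - Z) - S W * S W * S (3 * Z) * S Z)"
    by (intro jet_mult jet_diff f)
  moreover have "f Z t * f Z t * f (W + 2 * Z) t * f (W - 2 * Z) t =
      f (2 * Z) t * f (2 * Z) t * f (W + Z) t * f (W - Z) t - f W t * f W t * f (3 * Z) t * f Z t" for t
    using weierstrass_sigma_three_term[where z = "even_part Z + t * odd_part Z" and w = "even_part W + t * odd_part W"
        and ?g2.0 = "even_part G2 + t * odd_part G2" and ?g3.0 = "even_part G3 + t * odd_part G3"]
    by (simp add: f_def power2_eq_square algebra_simps)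
  ultimately show "jet (\<lambda>t. f Z t * f Z t * f (W + 2 * Z) t * f (W - 2 * Z) t)
     (S (2 * Z) * S (2 * Z) * S (W + Z) * S (W - Z) - S W * S W * S (3 * Z) * S Z)"
    by simp
qed

section \<open>The dual recurrence\<close>

lemma dual_somos4:
  fixes A B Z0 Z G2 G3
  defines "X \<equiv> dual_somos4_seq A B Z0 Z G2 G3" and "S \<equiv> \<lambda>U. dual_sigma U G2 G3"
  assumes B: "B \<in> dual_units" and s: "S Z \<in> dual_units"
  shows "X (n + 4) * X n = S (2 * Z) ^ 2 / S Z ^ 8 * X (n + 3) * X (n + 1)
    + - S (3 * Z) / S Z ^ 9 * X (n + 2) ^ 2"
proof -
  \<comment> \<open>Centring at index n + 2 turns the five arguments into W, W + Z, W - Z, W + 2 Z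
    and W - 2 Z.\<close>
  define W where "W = Z0 + of_int (n + 2) * Z"
  define p where "p k = S Z powi (- k)" for k
  have p_add: "p (j + k) = p j * p k" for j k
    unfolding p_def using dual_unit_power_int(1)[OF s, of "- j" "- k"] by simp
  have X_eq: "X k = A * B powi k * S (Z0 + of_int k * Z) * p (k\<^sup>2)" for k
    using dual_unit_power_int(2)[OF s, of "k\<^sup>2"]
    by (simp add: X_def dual_somos4_seq_def divide_dual_def p_def S_def)
  have div: "Y / S Z ^ k = Y * p (int k)" for Y k
    using dual_unit_power_int(2)[OF s, of "int k"] by (simp add: divide_dual_def p_def)
  have args: "Z0 + of_int (n + 4) * Z = W + 2 * Z" "Z0 + of_int n * Z = W - 2 * Z"
    "Z0 + of_int (n + 3) * Z = W + Z" "Z0 + of_int (n + 1) * Z = W - Z" "Z0 + of_int (n + 2) * Z = W"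
    by (simp_all add: W_def algebra_simps)
  \<comment> \<open>The exponents of 1/S(Z) in the three terms exceed 2 (n + 2)^2 by 8, by 8 + 2 =
    10 and by 9. With the largest one as common factor, the terms keep S(Z)^2, 1 and S(Z), as in the
    three-term relation.\<close>
  define K where "K = p (2 * (n + 2)\<^sup>2 + 10)"
  define C where "C = B powi (2 * (n + 2))"
  have s_p: "S Z * p (k + 1) = p k" for k
  proof -
    have "S Z * p 1 = 1"
      using dual_mult_inverse[OF s] by (simp add: p_def power_int_def)
    moreover have "S Z * p (k + 1) = p k * (S Z * p 1)"
      unfolding p_add by (simp only: mult_ac)
    ultimately show ?thesis by simp
  qed
  have "p ((n + 4)\<^sup>2) * p (n\<^sup>2) = p (2 * (n + 2)\<^sup>2 + 8)"
    unfolding p_add[symmetric] by (rule arg_cong[of _ _ p]) algebra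
  also have "\<dots> = S Z * S Z * K"
    using s_p[of "2 * (n + 2)\<^sup>2 + 8"] s_p[of "2 * (n + 2)\<^sup>2 + 9"] by (simp add: K_def mult.assoc add.commute)
  finally have K1: "p ((n + 4)\<^sup>2) * p (n\<^sup>2) = S Z * S Z * K" .
  have K2: "p 8 * p ((n + 3)\<^sup>2) * p ((n + 1)\<^sup>2) = K"
    unfolding p_add[symmetric] K_def by (rule arg_cong[of _ _ p]) algebra
  have "p 9 * p ((n + 2)\<^sup>2) * p ((n + 2)\<^sup>2) = p (2 * (n + 2)\<^sup>2 + 9)"
    unfolding p_add[symmetric] by (rule arg_cong[of _ _ p]) algebra
  also have "\<dots> = S Z * K"
    using s_p[of "2 * (n + 2)\<^sup>2 + 9"] by (simp add: K_def add.commute)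
  finally have K3: "p 9 * p ((n + 2)\<^sup>2) * p ((n + 2)\<^sup>2) = S Z * K" .
  have C: "B powi (n + 4) * B powi n = C" "B powi (n + 3) * B powi (n + 1) = C"
    "B powi (n + 2) * B powi (n + 2) = C"
    unfolding C_def dual_unit_power_int(1)[OF B, symmetric] by (simp_all add: algebra_simps)
  have "X (n + 4) * X n = A * A * (B powi (n + 4) * B powi n) * (S (W + 2 * Z) * S (W - 2 * Z))
      * (p ((n + 4)\<^sup>2) * p (n\<^sup>2))"
    unfolding X_eq args by (simp only: mult_ac)
  also have "\<dots> = A * A * C * K * (S Z * S Z * S (W + 2 * Z) * S (W - 2 * Z))"
    unfolding C K1 by (simp only: mult_ac)
  also have "\<dots> = A * A * C * K * (S (2 * Z) * S (2 * Z) * S (W + Z) * S (W - Z) - S W * S W * S (3 * Z) * S Z)"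
    unfolding S_def dual_sigma_three_term ..
  also have "\<dots> = S (2 * Z) * S (2 * Z) * (A * A) * C * (S (W + Z) * S (W - Z)) * K
      - S (3 * Z) * (A * A) * C * (S W * S W) * (S Z * K)"
    by (simp only: right_diff_distrib mult_ac)
  also have "\<dots> = S (2 * Z) ^ 2 / S Z ^ 8 * X (n + 3) * X (n + 1) + - S (3 * Z) / S Z ^ 9 * X (n + 2) ^ 2"
  proof -
    have "S (2 * Z) ^ 2 / S Z ^ 8 * X (n + 3) * X (n + 1) =
        S (2 * Z) * S (2 * Z) * (A * A) * (B powi (n + 3) * B powi (n + 1)) * (S (W + Z) * S (W - Z))
          * (p 8 * p ((n + 3)\<^sup>2) * p ((n + 1)\<^sup>2))"
      unfolding X_eq args div power2_eq_square[of "S (2 * Z)"] of_nat_numeral by (simp only: mult_ac)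
    moreover have "- S (3 * Z) / S Z ^ 9 * X (n + 2) ^ 2 =
        - (S (3 * Z) * (A * A) * (B powi (n + 2) * B powi (n + 2)) * (S W * S W)
          * (p 9 * p ((n + 2)\<^sup>2) * p ((n + 2)\<^sup>2)))"
      unfolding X_eq args div power2_eq_square[of "_ * p ((n + 2)\<^sup>2)"] of_nat_numeral
      by (simp only: mult_ac mult_minus_left mult_minus_right)
    ultimately show ?thesis
      unfolding C K2 K3 by simp
  qed
  finally show ?thesis .
qed

section \<open>The component formula\<close>

lemma log_deriv_quotient_power_int:
  assumes "f field_differentiable at z" "g field_differentiable at z" "f z \<noteq> 0" "g z \<noteq> 0" "K \<noteq> 0"
  shows "log_deriv (\<lambda>t. K * f t / g t powi k) z = deriv f z / f z - of_int k * (deriv g z / g z)"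
proof -
  have f: "(f has_field_derivative deriv f z) (at z)" and g: "(g has_field_derivative deriv g z) (at z)"
    using assms by (simp_all add: DERIV_deriv_iff_field_differentiable)
  have "((\<lambda>t. K * f t * g t powi (- k)) has_field_derivative
      K * deriv f z * g z powi (- k) + K * f z * (of_int (- k) * g z powi (- k - 1) * deriv g z)) (at z)"
    using f g assms(4) by (auto intro!: derivative_eq_intros)
  then have "deriv (\<lambda>t. K * f t / g t powi k) z =
      K * deriv f z * g z powi (- k) + K * f z * (of_int (- k) * g z powi (- k - 1) * deriv g z)"
    by (simp add: DERIV_imp_deriv power_int_minus divide_inverse)
  then show ?thesis
    using assms(3-5) by (simp add: log_deriv_def power_int_minus power_int_diff field_simps)
qed

text \<open>The ratio of odd to even part is additive under products of units, so the factors
  contribute A1/A0, n B1/B0 and the logarithmic derivatives of the two sigma values, the second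
  multiplied by -n^2.\<close>

lemma dual_somos4_seq_components:
  fixes A0 A1 B0 B1 g2 g2t g3 g3t z0 z0t z zt :: complex and n :: int
  defines "w \<equiv> z0 + of_int n * z"
  assumes nz: "A0 \<noteq> 0" "B0 \<noteq> 0" "weierstrass_sigma z g2 g3 \<noteq> 0" "weierstrass_sigma w g2 g3 \<noteq> 0"
  shows "dual_somos4_seq (Dual A0 A1) (Dual B0 B1) (Dual z0 z0t) (Dual z zt) (Dual g2 g2t) (Dual g3 g3t) n =
    Dual (somos4_seq A0 B0 z0 z g2 g3 n) (somos4_seq A0 B0 z0 z g2 g3 n *
      (A1 / A0 + B1 / B0 * of_int n + z0t * weierstrass_zeta w g2 g3
       + (zt * log_deriv (\<lambda>t. somos4_seq A0 B0 z0 t g2 g3 n) z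
          + g2t * log_deriv (\<lambda>t. somos4_seq A0 B0 z0 z t g3 n) g2
          + g3t * log_deriv (\<lambda>t. somos4_seq A0 B0 z0 z g2 t n) g3)))"
proof -
  define \<sigma>w where "\<sigma>w = weierstrass_sigma w g2 g3"
  define \<sigma>z where "\<sigma>z = weierstrass_sigma z g2 g3"
  define dw1 where "dw1 = deriv (\<lambda>t. weierstrass_sigma t g2 g3) w"
  define dw2 where "dw2 = deriv (\<lambda>t. weierstrass_sigma w t g3) g2"
  define dw3 where "dw3 = deriv (\<lambda>t. weierstrass_sigma w g2 t) g3"
  define dz1 where "dz1 = deriv (\<lambda>t. weierstrass_sigma t g2 g3) z"
  define dz2 where "dz2 = deriv (\<lambda>t. weierstrass_sigma z t g3) g2"
  define dz3 where "dz3 = deriv (\<lambda>t. weierstrass_sigma z g2 t) g3"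
  have "((\<lambda>t. weierstrass_sigma t g2 g3) has_field_derivative dw1) (at w)"
    unfolding dw1_def DERIV_deriv_iff_field_differentiable by (rule weierstrass_sigma_field_differentiable)
  then have shift: "((\<lambda>t. weierstrass_sigma (z0 + of_int n * t) g2 g3) has_field_derivative dw1 * of_int n) (at z)"
    unfolding w_def by (rule DERIV_affine)
  have K: "A0 * B0 powi n \<noteq> 0" using nz by simp
  note fd = weierstrass_sigma_field_differentiable
  have l1: "log_deriv (\<lambda>t. somos4_seq A0 B0 z0 t g2 g3 n) z =
      of_int n * (dw1 / \<sigma>w) - of_int (n\<^sup>2) * (dz1 / \<sigma>z)"
  proof -
    have fdS: "(\<lambda>t. weierstrass_sigma (z0 + of_int n * t) g2 g3) field_differentiable at z"
      using shift by (auto simp: field_differentiable_def)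
    have nzS: "weierstrass_sigma (z0 + of_int n * z) g2 g3 \<noteq> 0"
      using nz(4) by (simp add: w_def)
    show ?thesis
      unfolding somos4_seq_def log_deriv_quotient_power_int[OF fdS fd(1) nzS nz(3) K] DERIV_imp_deriv[OF shift]
      by (simp add: \<sigma>w_def \<sigma>z_def dz1_def w_def mult.commute)
  qed
  have l2: "log_deriv (\<lambda>t. somos4_seq A0 B0 z0 z t g3 n) g2 = dw2 / \<sigma>w - of_int (n\<^sup>2) * (dz2 / \<sigma>z)"
    unfolding somos4_seq_def \<sigma>w_def \<sigma>z_def dz2_def dw2_def w_def[symmetric]
    by (rule log_deriv_quotient_power_int[OF fd(2) fd(2) nz(4,3) K])
  have l3: "log_deriv (\<lambda>t. somos4_seq A0 B0 z0 z g2 t n) g3 = dw3 / \<sigma>w - of_int (n\<^sup>2) * (dz3 / \<sigma>z)"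
    unfolding somos4_seq_def \<sigma>w_def \<sigma>z_def dz3_def dw3_def w_def[symmetric]
    by (rule log_deriv_quotient_power_int[OF fd(3) fd(3) nz(4,3) K])
  have \<zeta>: "weierstrass_zeta w g2 g3 = dw1 / \<sigma>w"
    by (simp add: weierstrass_zeta_def log_deriv_def dw1_def \<sigma>w_def)
  have Sz: "dual_sigma (Dual z zt) (Dual g2 g2t) (Dual g3 g3t) = Dual \<sigma>z (zt * dz1 + g2t * dz2 + g3t * dz3)"
    by (simp add: dual_sigma_def dual_eval3_def Let_def \<sigma>z_def dz1_def dz2_def dz3_def)
  have Sw: "dual_sigma (Dual z0 z0t + of_int n * Dual z zt) (Dual g2 g2t) (Dual g3 g3t)
      = Dual \<sigma>w ((z0t + of_int n * zt) * dw1 + g2t * dw2 + g3t * dw3)"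
    by (simp add: dual_sigma_def dual_eval3_def Let_def \<sigma>w_def dw1_def dw2_def dw3_def w_def)
  have \<sigma>z: "\<sigma>z \<noteq> 0" and \<sigma>w: "\<sigma>w \<noteq> 0" using nz by (simp_all add: \<sigma>z_def \<sigma>w_def)
  have unit: "Dual \<sigma>z (zt * dz1 + g2t * dz2 + g3t * dz3) \<in> dual_units"
    using \<sigma>z by (simp add: dual_units_def)
  define b where "b = B0 powi n"
  define p where "p = \<sigma>z powi (- (n\<^sup>2))"
  have x: "somos4_seq A0 B0 z0 z g2 g3 n = A0 * b * \<sigma>w * p"
    by (simp add: somos4_seq_def \<sigma>w_def \<sigma>z_def b_def p_def w_def power_int_minus divide_inverse)
  have "dual_somos4_seq (Dual A0 A1) (Dual B0 B1) (Dual z0 z0t) (Dual z zt) (Dual g2 g2t) (Dual g3 g3t) n =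
      Dual A0 A1 * Dual b (of_int n * b * (B1 / B0))
      * Dual \<sigma>w ((z0t + of_int n * zt) * dw1 + g2t * dw2 + g3t * dw3)
      * Dual p (- of_int (n\<^sup>2) * p * ((zt * dz1 + g2t * dz2 + g3t * dz3) / \<sigma>z))"
    unfolding dual_somos4_seq_def Sz Sw divide_dual_def dual_unit_power_int(2)[OF unit]
    unfolding power_int_dual[OF \<sigma>z] power_int_dual[OF nz(2)] b_def p_def by simp
  also have "\<dots> = Dual (A0 * b * \<sigma>w * p) (A0 * b * \<sigma>w * p *
      (A1 / A0 + B1 / B0 * of_int n + ((z0t + of_int n * zt) * dw1 + g2t * dw2 + g3t * dw3) / \<sigma>w
        - of_int (n\<^sup>2) * ((zt * dz1 + g2t * dz2 + g3t * dz3) / \<sigma>z)))"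
    using nz(1,2) \<sigma>z \<sigma>w by (simp add: times_dual_def field_simps)
  \<comment> \<open>The argument of the numerator has odd part z0t + n zt. The share of z0t is the
    zeta term; that of n zt belongs to the z-derivative of log x_n, where the inner derivative of z0
    + n z is n.\<close>
  also have "\<dots> = Dual (A0 * b * \<sigma>w * p) (A0 * b * \<sigma>w * p *
      (A1 / A0 + B1 / B0 * of_int n + z0t * weierstrass_zeta w g2 g3
       + (zt * log_deriv (\<lambda>t. somos4_seq A0 B0 z0 t g2 g3 n) z
          + g2t * log_deriv (\<lambda>t. somos4_seq A0 B0 z0 z t g3 n) g2
          + g3t * log_deriv (\<lambda>t. somos4_seq A0 B0 z0 z g2 t n) g3)))"
    unfolding l1 l2 l3 \<zeta> by (simp add: add_divide_distrib algebra_simps)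
  finally show ?thesis
    unfolding x .
qed

text \<open>The component formula is asserted where sigma(z0 + n z) is nonzero, since its zeta and
  log x_n terms are singular at the zeros of sigma; the recurrence is asserted for every integer
  n.\<close>

theorem proposition2p2:
  fixes A0 A1 B0 B1 g2 g2t g3 g3t z0 z0t z zt :: complex
    and A B G2 G3 Z0 Z \<alpha> \<beta> :: dual
    and X :: "int \<Rightarrow> dual" and x :: "int \<Rightarrow> complex"
  assumes "A = Dual A0 A1" and "B = Dual B0 B1"
    and "G2 = Dual g2 g2t" and "G3 = Dual g3 g3t"
    and "Z0 = Dual z0 z0t" and "Z = Dual z zt"
    and "A \<in> dual_units" and "B \<in> dual_units"
    and "dual_sigma Z G2 G3 \<in> dual_units"
    and "X = dual_somos4_seq A B Z0 Z G2 G3"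
    and "x = somos4_seq A0 B0 z0 z g2 g3"
    and "\<alpha> = dual_sigma (2 * Z) G2 G3 ^ 2 / dual_sigma Z G2 G3 ^ 8"
    and "\<beta> = - dual_sigma (3 * Z) G2 G3 / dual_sigma Z G2 G3 ^ 9"
  shows "(\<forall>n. X (n + 4) * X n = \<alpha> * X (n + 3) * X (n + 1) + \<beta> * X (n + 2) ^ 2) \<and>
    (\<forall>n. weierstrass_sigma (z0 + of_int n * z) g2 g3 \<noteq> 0 \<longrightarrow>
      X n = Dual (x n) (x n *
        (A1 / A0 + B1 / B0 * of_int n + z0t * weierstrass_zeta (z0 + of_int n * z) g2 g3
         + (zt * log_deriv (\<lambda>t. somos4_seq A0 B0 z0 t g2 g3 n) z
            + g2t * log_deriv (\<lambda>t. somos4_seq A0 B0 z0 z t g3 n) g2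
            + g3t * log_deriv (\<lambda>t. somos4_seq A0 B0 z0 z g2 t n) g3))))"
proof (intro conjI allI impI)
  fix n
  show "X (n + 4) * X n = \<alpha> * X (n + 3) * X (n + 1) + \<beta> * X (n + 2) ^ 2"
    unfolding assms(10,12,13) by (rule dual_somos4[OF assms(8,9)])
  have "A0 \<noteq> 0" "B0 \<noteq> 0" "weierstrass_sigma z g2 g3 \<noteq> 0"
    using assms(7-9) unfolding assms(1-6)
    by (simp_all add: dual_units_def dual_sigma_def dual_eval3_def Let_def)
  then show "X n = Dual (x n) (x n *
        (A1 / A0 + B1 / B0 * of_int n + z0t * weierstrass_zeta (z0 + of_int n * z) g2 g3
         + (zt * log_deriv (\<lambda>t. somos4_seq A0 B0 z0 t g2 g3 n) z
            + g2t * log_deriv (\<lambda>t. somos4_seq A0 B0 z0 z t g3 n) g2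
            + g3t * log_deriv (\<lambda>t. somos4_seq A0 B0 z0 z g2 t n) g3)))"
    if "weierstrass_sigma (z0 + of_int n * z) g2 g3 \<noteq> 0"
    unfolding assms(1-6,10,11) using that by (rule dual_somos4_seq_components)
qed

end
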